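(* Assume (A1)-(A5) and $\mathcal Q(x)=\mathcal Q+\mathrm o(1)$ as $|x|\to\infty$ (i.e. $\lim_{|x|\to\infty}(\mathcal Q(x)-\mathcal Q)=0$ for a matrix $\mathcal Q=(\mathrm q_{ij})_{i,j\in\mathbb S}$). Furthermore, assume that there are $\{c_i\}_{i\in\mathbb S}\subset\mathbb R$ such that one of the following conditions holds: (i) $\mathcal Q$ is the infinitesimal generator of an irreducible right-continuous temporally-homogeneous Markov chain on $\mathbb S$ with invariant probability measure $\lambda=(\lambda_i)_{i\in\mathbb S}$, $\sum_{i\in\mathbb S}c_i\lambda_i<0$, and there are a twice continuously differentiable $\mathsf V:\mathbb R^d\to(0,\infty)$ and a twice continuously differentiable concave $\theta:(0,\infty)\to(0,\infty)$ such that $$\lim_{|x|\to\infty}\theta\circ\mathsf V(x)=\infty,\qquad\limsup_{|x|\to\infty}\frac{\mathcal L_i\mathsf V(x)}{\theta\circ\mathsf V(x)}<c_i\ \text{ for every }i\in\mathbb S,$$ $$\lim_{|x|\to\infty}\frac{\theta\circ\mathsf V(x)}{\mathsf V(x)}=0,\qquad\lim_{|x|\to\infty}\sup_{i\in\mathbb S}\frac{\mathcal L_i(\theta\circ\mathsf V)(x)}{\theta\circ\mathsf V(x)}=0.$$ (ii) $\mathcal Q$ is the infinitesimal generator of an irreducible right-continuous temporally-homogeneous Markov chain on $\mathbb S$ with invariant probability measure $\lambda=(\lambda_i)_{i\in\mathbb S}$, $\sum_{i\in\mathbb S}c_i\lambda_i<0$, and there is a twice continuously differentiable $\mathsf V:\mathbb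 R^d\to(0,\infty)$ such that $$\lim_{|x|\to\infty}\mathsf V(x)=\infty\qquad\text{and}\qquad\limsup_{|x|\to\infty}\frac{\mathcal L_i\mathsf V(x)}{\mathsf V(x)}<c_i\ \text{ for every }i\in\mathbb S.$$ (iii) $-(\mathcal Q+\mathrm{diag}\,c)$ is a nonsingular $\mathcal M$-matrix, where $c=(c_i)_{i\in\mathbb S}$, and there is a twice continuously differentiable $\mathsf V:\mathbb R^d\to(0,\infty)$ such that $\lim_{|x|\to\infty}\mathsf V(x)=\infty$ and $\limsup_{|x|\to\infty}\mathcal L_i\mathsf V(x)/\mathsf V(x)<c_i$ for every $i\in\mathbb S$. Then there are a non-negative $\mathcal V\in\mathcal C^2(\mathbb R^d\times\mathbb S)$ and a locally bounded $g:\mathbb R^d\to\mathbb R$ such that $$\lim_{|x|\to\infty}g(x)=\infty\qquad\text{and}\qquad\mathcal L\mathcal V(x,i)\le-g(x)\quad\text{for all }(x,i)\in\mathbb R^d\times\mathbb S.$$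
   Context: Setting. $\mathbb S$ is a finite set, $\{\mathsf B(t)\}_{t\ge0}$ is a standard $n$-dimensional Brownian motion starting from the origin, $\mathrm b:\mathbb R^d\times\mathbb S\to\mathbb R^d$ and $\sigma:\mathbb R^d\times\mathbb S\to\mathbb R^{d\times n}$. The regime-switching diffusion process $\{(\mathsf X(x,i;t),\Lambda(x,i;t))\}_{t\ge0}$, $(x,i)\in\mathbb R^d\times\mathbb S$, has first component given by $$\mathrm d\mathsf X(x,i;t)=\mathrm b(\mathsf X(x,i;t),\Lambda(x,i;t))\,\mathrm dt+\sigma(\mathsf X(x,i;t),\Lambda(x,i;t))\,\mathrm d\mathsf B(t),\quad \mathsf X(x,i;0)=x,\ \Lambda(x,i;0)=i,\qquad( * )$$ and second component a right-continuous temporally-homogeneous Markov chain with state space $\mathbb S$; $\mathsf B$ and $\Lambda$ are defined on a stochastic basis $(\Omega,\mathcal F,\{\mathcal F_t\}_{t\ge0},\mathbb P)$ satisfying the usual conditions. Spaces of functions on $\mathbb R^d\times\mathbb S$ (such as $\mathcal B_b$, $\mathcal C_b$, $\mathcal C^2$: bounded Borel, bounded continuous, twice continuously differentiable) are understood as conditions on $x\mapsto f(x,i)$ for every $i\in\mathbb S$. $\mathscr B_r(x)$ is the open ball, $\|M\|_{\mathrm{HS}}^2=\mathrm{Tr}\,MM^T$. Assumptions: (A1) for any $r>0$, $i\in\mathbb S$: $\sup_{x\in\mathscr B_r(0)}(|\mathrm b(x,i)|+\|\sigma(x,i)\|_{\mathrm{HS}})<\infty$. (A2) for each $(x,i)$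 equation $( * )$ admits a unique nonexplosive strong solution with continuous sample paths. (A3) $\{(\mathsf X(x,i;t),\Lambda(x,i;t))\}_{t\ge0}$ is a temporally-homogeneous strong Markov process with transition kernel $\mathsf p(t,(x,i),\mathrm dy\times\{j\})=\mathbb P((\mathsf X(x,i;t),\Lambda(x,i;t))\in\mathrm dy\times\{j\})$. (A4) the semigroup $\mathcal P_tf(x,i)=\int_{\mathbb R^d\times\mathbb S}f(y,j)\,\mathsf p(t,(x,i),\mathrm dy\times\{j\})$, $f\in\mathcal B_b(\mathbb R^d\times\mathbb S)$, is $\mathcal C_b$-Feller: $\mathcal P_t(\mathcal C_b(\mathbb R^d\times\mathbb S))\subseteq\mathcal C_b(\mathbb R^d\times\mathbb S)$ for all $t\ge0$. (A5) for any $(x,i)$ and $f\in\mathcal C^2(\mathbb R^d\times\mathbb S)$ the process $f(\mathsf X(x,i;t),\Lambda(x,i;t))-f(x,i)-\int_0^t\mathcal Lf(\mathsf X(x,i;s),\Lambda(x,i;s))\,\mathrm ds$, $t\ge0$, is a $\mathbb P$-local martingale, where $\mathcal Lf(x,i)=\mathcal L_if(x,i)+\mathcal Q(x)f(x,i)$, $$\mathcal L_if(x)=\langle\mathrm b(x,i),\nabla f(x)\rangle+\tfrac12\mathrm{Tr}\bigl(\sigma(x,i)\sigma(x,i)^T\nabla^2f(x)\bigr),\quad f\in\mathcal C^2(\mathbb R^d),$$ and $\mathcal Q(x)=(\mathrm q_{ij}(x))_{i,j\in\mathbb S}$ is the infinitesimal generator of $\Lambda$: $\mathcal Q(x)f(i)=\sum_{j}f(j)\mathrm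 q_{ij}(x)$ with $\mathrm q_{ij}(x)=\lim_{t\to0}\mathbb P(\Lambda(x,i;t)=j)/t$ for $i\ne j$ and $\mathrm q_{ii}(x)=-\sum_{j\ne i}\mathrm q_{ij}(x)$. A Markov chain on $\mathbb S$ with generator $\mathcal Q=(\mathrm q_{ij})$ is irreducible if for any $i\ne j$ there are $m\in\mathbb N$ and $k_0=i,k_1,\dots,k_m=j$ with $k_l\ne k_{l+1}$ and $\mathrm q_{k_lk_{l+1}}>0$ for $l=0,\dots,m-1$. An $m\times m$ matrix $M$ is an $\mathcal M$-matrix if $M=\gamma\,\mathbb I_m-N$ for some $\gamma>0$ and some (entrywise) nonnegative $m\times m$ matrix $N$ with spectral radius $\varrho(N)\le\gamma$; it is nonsingular if, and only if, $\varrho(N)<\gamma$. *)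

theory Defs
  imports "HOL-Probability.Probability"
begin

section \<open>Differential calculus on \<open>\<real>\<^sup>d\<close>\<close>

definition grad :: "(real^'d \<Rightarrow> real) \<Rightarrow> real^'d \<Rightarrow> real^'d" where
  "grad f x = (\<chi> k. frechet_derivative f (at x) (axis k 1))"

definition hess :: "(real^'d \<Rightarrow> real) \<Rightarrow> real^'d \<Rightarrow> real^'d^'d" where
  "hess f x = jacobian (grad f) (at x)"

definition C2 :: "(real^'d \<Rightarrow> real) \<Rightarrow> bool" where
  "C2 f \<longleftrightarrow> (\<forall>x. f differentiable (at x)) \<and> (\<forall>x. grad f differentiable (at x))
     \<and> continuous_on UNIV (hess f)"

definition C2_halfline :: "(real \<Rightarrow> real) \<Rightarrow> bool" where
  "C2_halfline \<theta> \<longleftrightarrow> (\<forall>u>0. \<theta> differentiable (at u)) \<and> (\<forall>u>0. deriv \<theta> differentiable (at u))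
     \<and> continuous_on {0<..} (deriv (deriv \<theta>))"

definition hs_norm :: "real^'n^'d \<Rightarrow> real" where
  "hs_norm A = sqrt (trace (A ** transpose A))"

definition locally_bounded :: "(real^'d \<Rightarrow> real) \<Rightarrow> bool" where
  "locally_bounded g \<longleftrightarrow> (\<forall>x. \<exists>r>0. bounded (g ` ball x r))"

section \<open>The operators \<open>\<L>\<^sub>i\<close> and \<open>\<L>\<close>\<close>

definition diffusion_op ::
    "(real^'d \<Rightarrow> 's \<Rightarrow> real^'d) \<Rightarrow> (real^'d \<Rightarrow> 's \<Rightarrow> real^'n^'d) \<Rightarrow> 's
      \<Rightarrow> (real^'d \<Rightarrow> real) \<Rightarrow> real^'d \<Rightarrow> real" where
  "diffusion_op b \<sigma> i f x =
     b x i \<bullet> grad f x + 1 / 2 * trace (\<sigma> x i ** transpose (\<sigma> x i) ** hess f x)"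

definition switching_op ::
    "(real^'d \<Rightarrow> 's::finite \<Rightarrow> real^'d) \<Rightarrow> (real^'d \<Rightarrow> 's \<Rightarrow> real^'n^'d) \<Rightarrow> (real^'d \<Rightarrow> real^'s^'s)
      \<Rightarrow> (real^'d \<Rightarrow> 's \<Rightarrow> real) \<Rightarrow> real^'d \<Rightarrow> 's \<Rightarrow> real" where
  "switching_op b \<sigma> q f x i =
     diffusion_op b \<sigma> i (\<lambda>y. f y i) x + (\<Sum>j\<in>UNIV. f x j * q x $ i $ j)"

section \<open>Stochastic basis, Brownian motion, martingales\<close>

text \<open>Filtrations are indexed by \<^typ>\<open>real\<close>, so that the library notions of filtration and stopping
  time apply; the members with negative index play no role, since all stopping times considered
  below are nonnegative.\<close>

definition stochastic_basis :: "'w measure \<Rightarrow> (real \<Rightarrow> 'w measure) \<Rightarrow> bool" where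
  "stochastic_basis M F \<longleftrightarrow> prob_space M \<and> filtration (space M) F
     \<and> (\<forall>t. sets (F t) \<subseteq> sets M)
     \<and> (\<forall>t\<ge>0. (\<Inter>s\<in>{t<..}. sets (F s)) \<subseteq> sets (F t))
     \<and> (\<forall>N\<in>null_sets M. \<forall>A\<subseteq>N. A \<in> sets (F 0))"

definition brownian_motion ::
    "'w measure \<Rightarrow> (real \<Rightarrow> 'w measure) \<Rightarrow> (real \<Rightarrow> 'w \<Rightarrow> real^'n) \<Rightarrow> bool" where
  "brownian_motion M F B \<longleftrightarrow>
     (\<forall>\<omega>\<in>space M. B 0 \<omega> = 0 \<and> continuous_on {0..} (\<lambda>t. B t \<omega>))
     \<and> (\<forall>t\<ge>0. B t \<in> borel_measurable (F t))
     \<and> (\<forall>s\<ge>0. \<forall>t>s.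
          prob_space.indep_set M (sets (F s))
            (sets (vimage_algebra (space M) (\<lambda>\<omega>. B t \<omega> - B s \<omega>) borel))
        \<and> distributed M lborel (\<lambda>\<omega>. B t \<omega> - B s \<omega>)
            (\<lambda>z. ennreal (\<Prod>k\<in>UNIV. normal_density 0 (sqrt (t - s)) (z $ k))))"

definition martingale ::
    "'w measure \<Rightarrow> (real \<Rightarrow> 'w measure) \<Rightarrow> (real \<Rightarrow> 'w \<Rightarrow> real) \<Rightarrow> bool" where
  "martingale M F Y \<longleftrightarrow>
     (\<forall>t\<ge>0. integrable M (Y t) \<and> Y t \<in> borel_measurable (F t))
     \<and> (\<forall>s\<ge>0. \<forall>t\<ge>s. AE \<omega> in M. real_cond_exp M (F s) (Y t) \<omega> = Y s \<omega>)"

text \<open>Finite localizing times are no restriction: replace \<open>\<tau>\<^sub>k\<close> by \<open>min \<tau>\<^sub>k k\<close>.\<close>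

definition local_martingale ::
    "'w measure \<Rightarrow> (real \<Rightarrow> 'w measure) \<Rightarrow> (real \<Rightarrow> 'w \<Rightarrow> real) \<Rightarrow> bool" where
  "local_martingale M F Y \<longleftrightarrow>
     (\<forall>t\<ge>0. Y t \<in> borel_measurable (F t))
     \<and> (\<exists>\<tau> :: nat \<Rightarrow> 'w \<Rightarrow> real.
          (\<forall>k. stopping_time F (\<tau> k) \<and> (\<forall>\<omega>\<in>space M. 0 \<le> \<tau> k \<omega>))
        \<and> (AE \<omega> in M. incseq (\<lambda>k. \<tau> k \<omega>) \<and> filterlim (\<lambda>k. \<tau> k \<omega>) at_top sequentially)
        \<and> (\<forall>k. martingale M F (\<lambda>t \<omega>. Y (min t (\<tau> k \<omega>)) \<omega>)))"

section \<open>It\^o integral and strong solutions\<close>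

definition progressive ::
    "'w measure \<Rightarrow> (real \<Rightarrow> 'w measure) \<Rightarrow> (real \<Rightarrow> 'w \<Rightarrow> 'b::topological_space) \<Rightarrow> bool" where
  "progressive M F H \<longleftrightarrow>
     (\<forall>T\<ge>0. (\<lambda>(t, \<omega>). H t \<omega>)
        \<in> borel_measurable (restrict_space (borel :: real measure) {0..T} \<Otimes>\<^sub>M F T))"

text \<open>An elementary integrand \<open>\<Sum>k<m. \<xi>\<^sub>k 1\<^bsub>(u\<^sub>k, u\<^sub>k\<^sub>+\<^sub>1]\<^esub>\<close> is given by the data \<open>m\<close>, \<open>u\<close>, \<open>\<xi>\<close>.\<close>

definition elementary ::
    "'w measure \<Rightarrow> (real \<Rightarrow> 'w measure) \<Rightarrow> nat \<Rightarrow> (nat \<Rightarrow> real)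
      \<Rightarrow> (nat \<Rightarrow> 'w \<Rightarrow> real^'n^'d) \<Rightarrow> bool" where
  "elementary M F m u \<xi> \<longleftrightarrow>
     (\<forall>k<m. 0 \<le> u k \<and> u k < u (Suc k)
        \<and> \<xi> k \<in> borel_measurable (F (u k)) \<and> bounded (\<xi> k ` space M))"

definition elementary_process ::
    "nat \<Rightarrow> (nat \<Rightarrow> real) \<Rightarrow> (nat \<Rightarrow> 'w \<Rightarrow> real^'n^'d) \<Rightarrow> real \<Rightarrow> 'w \<Rightarrow> real^'n^'d" where
  "elementary_process m u \<xi> t \<omega> = (\<Sum>k<m. indicator {u k<..u (Suc k)} t *\<^sub>R \<xi> k \<omega>)"

definition elementary_integral ::
    "(real \<Rightarrow> 'w \<Rightarrow> real^'n) \<Rightarrow> nat \<Rightarrow> (nat \<Rightarrow> real) \<Rightarrow> (nat \<Rightarrow> 'w \<Rightarrow> real^'n^'d)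
      \<Rightarrow> real \<Rightarrow> 'w \<Rightarrow> real^'d" where
  "elementary_integral B m u \<xi> t \<omega> =
     (\<Sum>k<m. \<xi> k \<omega> *v (B (min t (u (Suc k))) \<omega> - B (min t (u k)) \<omega>))"

text \<open>\<open>is_ito_integral M F B H I\<close> says that \<open>I\<close> is a version of the process
  \<open>\<integral>\<^sub>0\<^sup>t H\<^sub>s dB\<^sub>s\<close>: the integrand \<open>H\<close> is progressive and locally square integrable almost surely,
  and \<open>I\<close> is the limit, uniformly on compact time intervals in probability, of the integrals of
  elementary integrands that approximate \<open>H\<close>.  The norm on matrices is the Hilbert--Schmidt norm.\<close>

definition is_ito_integral ::
    "'w measure \<Rightarrow> (real \<Rightarrow> 'w measure) \<Rightarrow> (real \<Rightarrow> 'w \<Rightarrow> real^'n)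
      \<Rightarrow> (real \<Rightarrow> 'w \<Rightarrow> real^'n^'d) \<Rightarrow> (real \<Rightarrow> 'w \<Rightarrow> real^'d) \<Rightarrow> bool" where
  "is_ito_integral M F B H I \<longleftrightarrow>
     progressive M F H
     \<and> (AE \<omega> in M. \<forall>T\<ge>0. (\<integral>\<^sup>+ s\<in>{0..T}. ennreal ((norm (H s \<omega>))\<^sup>2) \<partial>lborel) < \<infinity>)
     \<and> (\<forall>t\<ge>0. I t \<in> borel_measurable (F t))
     \<and> (AE \<omega> in M. continuous_on {0..} (\<lambda>t. I t \<omega>))
     \<and> (\<exists>m u \<xi>. (\<forall>k. elementary M F (m k) (u k) (\<xi> k))
          \<and> (\<forall>T\<ge>0. \<forall>\<epsilon>>0.
               (\<lambda>k::nat. \<P>(\<omega> in M.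
                  (\<integral>\<^sup>+ s\<in>{0..T}. ennreal ((norm (elementary_process (m k) (u k) (\<xi> k) s \<omega> - H s \<omega>))\<^sup>2)
                     \<partial>lborel) > ennreal \<epsilon>)) \<longlonglongrightarrow> 0
             \<and> (\<lambda>k::nat. \<P>(\<omega> in M.
                  \<exists>t\<in>{0..T}. norm (elementary_integral B (m k) (u k) (\<xi> k) t \<omega> - I t \<omega>) > \<epsilon>))
                 \<longlonglongrightarrow> 0))"

definition augmented_history ::
    "'w measure \<Rightarrow> (real \<Rightarrow> 'w \<Rightarrow> real^'n) \<Rightarrow> (real \<Rightarrow> 'w \<Rightarrow> 's) \<Rightarrow> real \<Rightarrow> 'w measure" where
  "augmented_history M B L t = sigma (space M)
     ({B s -` A \<inter> space M | s A. 0 \<le> s \<and> s \<le> t \<and> A \<in> sets borel}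
      \<union> {L s -` {j} \<inter> space M | s j. 0 \<le> s \<and> s \<le> t}
      \<union> {A. \<exists>N\<in>null_sets M. A \<subseteq> N})"

text \<open>For a given switching process \<open>L\<close>, a strong solution of
  \<open>dY\<^sub>t = b(Y\<^sub>t, L\<^sub>t) dt + \<sigma>(Y\<^sub>t, L\<^sub>t) dB\<^sub>t\<close>, \<open>Y\<^sub>0 = x\<close>, is a solution on the given stochastic basis
  that is adapted to the completed filtration of the driving processes \<open>B\<close> and \<open>L\<close>.  It is
  nonexplosive because it takes its values in \<open>\<real>\<^sup>d\<close> at all times.\<close>

definition strong_solution ::
    "'w measure \<Rightarrow> (real \<Rightarrow> 'w measure) \<Rightarrow> (real \<Rightarrow> 'w \<Rightarrow> real^'n)
      \<Rightarrow> (real^'d \<Rightarrow> 's \<Rightarrow> real^'d) \<Rightarrow> (real^'d \<Rightarrow> 's \<Rightarrow> real^'n^'d)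
      \<Rightarrow> (real \<Rightarrow> 'w \<Rightarrow> 's) \<Rightarrow> real^'d \<Rightarrow> (real \<Rightarrow> 'w \<Rightarrow> real^'d) \<Rightarrow> bool" where
  "strong_solution M F B b \<sigma> L x Y \<longleftrightarrow>
     (\<forall>t\<ge>0. Y t \<in> borel_measurable (augmented_history M B L t))
     \<and> (\<forall>\<omega>\<in>space M. Y 0 \<omega> = x \<and> continuous_on {0..} (\<lambda>t. Y t \<omega>))
     \<and> progressive M F (\<lambda>t \<omega>. b (Y t \<omega>) (L t \<omega>))
     \<and> (AE \<omega> in M. \<forall>t\<ge>0. set_integrable lborel {0..t} (\<lambda>s. b (Y s \<omega>) (L s \<omega>)))
     \<and> (\<exists>I. is_ito_integral M F B (\<lambda>t \<omega>. \<sigma> (Y t \<omega>) (L t \<omega>)) I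
          \<and> (AE \<omega> in M. \<forall>t\<ge>0.
               Y t \<omega> = x + (LINT s:{0..t}|lborel. b (Y s \<omega>) (L s \<omega>)) + I t \<omega>))"

definition unique_strong_solution ::
    "'w measure \<Rightarrow> (real \<Rightarrow> 'w measure) \<Rightarrow> (real \<Rightarrow> 'w \<Rightarrow> real^'n)
      \<Rightarrow> (real^'d \<Rightarrow> 's \<Rightarrow> real^'d) \<Rightarrow> (real^'d \<Rightarrow> 's \<Rightarrow> real^'n^'d)
      \<Rightarrow> (real \<Rightarrow> 'w \<Rightarrow> 's) \<Rightarrow> real^'d \<Rightarrow> (real \<Rightarrow> 'w \<Rightarrow> real^'d) \<Rightarrow> bool" where
  "unique_strong_solution M F B b \<sigma> L x Y \<longleftrightarrow>
     strong_solution M F B b \<sigma> L x Y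
     \<and> (\<forall>Z. strong_solution M F B b \<sigma> L x Z \<longrightarrow> (AE \<omega> in M. \<forall>t\<ge>0. Z t \<omega> = Y t \<omega>))"

section \<open>Markov chains with finite state space\<close>

definition right_continuous_path :: "(real \<Rightarrow> 's) \<Rightarrow> bool" where
  "right_continuous_path y \<longleftrightarrow> (\<forall>t\<ge>0. \<forall>\<^sub>F s in at_right t. y s = y t)"

definition history :: "'v measure \<Rightarrow> (real \<Rightarrow> 'v \<Rightarrow> 's) \<Rightarrow> real \<Rightarrow> 'v measure" where
  "history N Y t = sigma (space N) {Y u -` {j} \<inter> space N | u j. 0 \<le> u \<and> u \<le> t}"

text \<open>\<open>Y i\<close> is the chain started at \<open>i\<close>.\<close>

definition markov_chain :: "'v measure \<Rightarrow> ('s::finite \<Rightarrow> real \<Rightarrow> 'v \<Rightarrow> 's) \<Rightarrow> bool" where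
  "markov_chain N Y \<longleftrightarrow> prob_space N \<and>
     (\<forall>i. (\<forall>t\<ge>0. Y i t \<in> N \<rightarrow>\<^sub>M count_space UNIV)
        \<and> (\<forall>\<omega>\<in>space N. Y i 0 \<omega> = i \<and> right_continuous_path (\<lambda>t. Y i t \<omega>))
        \<and> (\<forall>s\<ge>0. \<forall>t\<ge>0. \<forall>j. AE \<omega> in N.
             real_cond_exp N (history N (Y i) s) (indicator {\<eta>. Y i (s + t) \<eta> = j}) \<omega>
               = \<P>(\<eta> in N. Y (Y i s \<omega>) t \<eta> = j)))"

definition infinitesimal_generator ::
    "'v measure \<Rightarrow> ('s::finite \<Rightarrow> real \<Rightarrow> 'v \<Rightarrow> 's) \<Rightarrow> real^'s^'s \<Rightarrow> bool" where
  "infinitesimal_generator N Y Q \<longleftrightarrow>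
     (\<forall>i j. i \<noteq> j \<longrightarrow> ((\<lambda>t. \<P>(\<omega> in N. Y i t \<omega> = j) / t) \<longlongrightarrow> Q $ i $ j) (at_right 0))
     \<and> (\<forall>i. Q $ i $ i = - (\<Sum>j\<in>UNIV - {i}. Q $ i $ j))"

definition irreducible_generator :: "real^'s^'s \<Rightarrow> bool" where
  "irreducible_generator Q \<longleftrightarrow> (\<forall>i j. i \<noteq> j \<longrightarrow>
     (\<exists>m (k :: nat \<Rightarrow> 's). k 0 = i \<and> k m = j
        \<and> (\<forall>l<m. k l \<noteq> k (Suc l) \<and> Q $ k l $ k (Suc l) > 0)))"

definition invariant_measure ::
    "'v measure \<Rightarrow> ('s::finite \<Rightarrow> real \<Rightarrow> 'v \<Rightarrow> 's) \<Rightarrow> 's pmf \<Rightarrow> bool" where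
  "invariant_measure N Y \<mu> \<longleftrightarrow>
     (\<forall>t\<ge>0. \<forall>j. (\<Sum>i\<in>UNIV. pmf \<mu> i * \<P>(\<omega> in N. Y i t \<omega> = j)) = pmf \<mu> j)"

section \<open>The regime-switching diffusion\<close>

text \<open>\<open>X x i\<close> and \<open>\<Lambda> x i\<close> are the two components started at \<open>(x, i)\<close>.\<close>

abbreviation state_algebra :: "((real^'d) \<times> 's) measure" where
  "state_algebra \<equiv> borel \<Otimes>\<^sub>M count_space UNIV"

definition trans_kernel ::
    "'w measure \<Rightarrow> (real^'d \<Rightarrow> 's \<Rightarrow> real \<Rightarrow> 'w \<Rightarrow> real^'d) \<Rightarrow> (real^'d \<Rightarrow> 's \<Rightarrow> real \<Rightarrow> 'w \<Rightarrow> 's)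
      \<Rightarrow> real \<Rightarrow> (real^'d) \<times> 's \<Rightarrow> ((real^'d) \<times> 's) measure" where
  "trans_kernel M X \<Lambda> t = (\<lambda>(x, i). distr M state_algebra (\<lambda>\<omega>. (X x i t \<omega>, \<Lambda> x i t \<omega>)))"

text \<open>Since its transition intensities \<open>\<Q>(x)\<close> depend on the current position of the diffusion, the
  switching component is a Markov chain in the sense that its transition law from time \<open>s\<close> on is
  determined by its current state and that current position; it is a Markov chain on its own when
  the transition law does not depend on the position.\<close>

definition switching_chain ::
    "'w measure \<Rightarrow> (real \<Rightarrow> 'w measure) \<Rightarrow> (real^'d \<Rightarrow> 's \<Rightarrow> real \<Rightarrow> 'w \<Rightarrow> real^'d)
      \<Rightarrow> (real^'d \<Rightarrow> 's::finite \<Rightarrow> real \<Rightarrow> 'w \<Rightarrow> 's) \<Rightarrow> bool" where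
  "switching_chain M F X \<Lambda> \<longleftrightarrow>
     (\<forall>x i. (\<forall>t\<ge>0. \<Lambda> x i t \<in> F t \<rightarrow>\<^sub>M count_space UNIV)
        \<and> (\<forall>\<omega>\<in>space M. \<Lambda> x i 0 \<omega> = i \<and> right_continuous_path (\<lambda>t. \<Lambda> x i t \<omega>))
        \<and> (\<forall>s\<ge>0. \<forall>t\<ge>0. \<forall>j. AE \<omega> in M.
             real_cond_exp M (F s) (indicator {\<eta>. \<Lambda> x i (s + t) \<eta> = j}) \<omega>
               = \<P>(\<eta> in M. \<Lambda> (X x i s \<omega>) (\<Lambda> x i s \<omega>) t \<eta> = j)))"

definition coefficients_locally_bounded ::
    "(real^'d \<Rightarrow> 's \<Rightarrow> real^'d) \<Rightarrow> (real^'d \<Rightarrow> 's \<Rightarrow> real^'n^'d) \<Rightarrow> bool" where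
  "coefficients_locally_bounded b \<sigma> \<longleftrightarrow>
     (\<forall>r>0. \<forall>i. bdd_above ((\<lambda>x. norm (b x i) + hs_norm (\<sigma> x i)) ` ball 0 r))"

text \<open>Considering only finite stopping times is no restriction: the Markov property at a general
  \<open>\<tau>\<close> on \<open>{\<tau> < \<infinity>}\<close> follows from the one at \<open>min \<tau> k\<close> on \<open>{\<tau> \<le> k}\<close>.\<close>

definition strong_markov ::
    "'w measure \<Rightarrow> (real \<Rightarrow> 'w measure) \<Rightarrow> (real^'d \<Rightarrow> 's \<Rightarrow> real \<Rightarrow> 'w \<Rightarrow> real^'d)
      \<Rightarrow> (real^'d \<Rightarrow> 's::finite \<Rightarrow> real \<Rightarrow> 'w \<Rightarrow> 's) \<Rightarrow> bool" where
  "strong_markov M F X \<Lambda> \<longleftrightarrow>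
     (\<forall>x i. \<forall>t\<ge>0. (\<lambda>\<omega>. (X x i t \<omega>, \<Lambda> x i t \<omega>)) \<in> F t \<rightarrow>\<^sub>M state_algebra)
     \<and> (\<forall>t\<ge>0. trans_kernel M X \<Lambda> t \<in> state_algebra \<rightarrow>\<^sub>M prob_algebra state_algebra)
     \<and> (\<forall>x i. \<forall>\<tau> t A.
          stopping_time F \<tau> \<and> (\<forall>\<omega>\<in>space M. 0 \<le> \<tau> \<omega>) \<and> 0 \<le> t \<and> A \<in> sets state_algebra \<longrightarrow>
          (AE \<omega> in M.
             real_cond_exp M (filtration.pre_sigma (space M) F \<tau>)
               (\<lambda>\<eta>. indicator A (X x i (\<tau> \<eta> + t) \<eta>, \<Lambda> x i (\<tau> \<eta> + t) \<eta>)) \<omega>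
             = measure (trans_kernel M X \<Lambda> t (X x i (\<tau> \<omega>) \<omega>, \<Lambda> x i (\<tau> \<omega>) \<omega>)) A))"

definition bounded_continuous :: "(real^'d \<Rightarrow> 's \<Rightarrow> real) \<Rightarrow> bool" where
  "bounded_continuous f \<longleftrightarrow>
     (\<forall>i. continuous_on UNIV (\<lambda>x. f x i) \<and> bounded (range (\<lambda>x. f x i)))"

definition semigroup ::
    "'w measure \<Rightarrow> (real^'d \<Rightarrow> 's \<Rightarrow> real \<Rightarrow> 'w \<Rightarrow> real^'d) \<Rightarrow> (real^'d \<Rightarrow> 's \<Rightarrow> real \<Rightarrow> 'w \<Rightarrow> 's)
      \<Rightarrow> real \<Rightarrow> (real^'d \<Rightarrow> 's \<Rightarrow> real) \<Rightarrow> real^'d \<Rightarrow> 's \<Rightarrow> real" where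
  "semigroup M X \<Lambda> t f x i = (\<integral>z. f (fst z) (snd z) \<partial>(trans_kernel M X \<Lambda> t (x, i)))"

definition Cb_Feller ::
    "'w measure \<Rightarrow> (real^'d \<Rightarrow> 's \<Rightarrow> real \<Rightarrow> 'w \<Rightarrow> real^'d)
      \<Rightarrow> (real^'d \<Rightarrow> 's \<Rightarrow> real \<Rightarrow> 'w \<Rightarrow> 's) \<Rightarrow> bool" where
  "Cb_Feller M X \<Lambda> \<longleftrightarrow>
     (\<forall>t\<ge>0. \<forall>f. bounded_continuous f \<longrightarrow> bounded_continuous (semigroup M X \<Lambda> t f))"

text \<open>The integrability clause expresses that the process in the martingale problem is well defined;
  a Bochner integral that does not exist is 0 by convention.\<close>

definition martingale_problem ::
    "'w measure \<Rightarrow> (real \<Rightarrow> 'w measure)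
      \<Rightarrow> (real^'d \<Rightarrow> 's::finite \<Rightarrow> real^'d) \<Rightarrow> (real^'d \<Rightarrow> 's \<Rightarrow> real^'n^'d) \<Rightarrow> (real^'d \<Rightarrow> real^'s^'s)
      \<Rightarrow> (real^'d \<Rightarrow> 's \<Rightarrow> real \<Rightarrow> 'w \<Rightarrow> real^'d) \<Rightarrow> (real^'d \<Rightarrow> 's \<Rightarrow> real \<Rightarrow> 'w \<Rightarrow> 's) \<Rightarrow> bool" where
  "martingale_problem M F b \<sigma> q X \<Lambda> \<longleftrightarrow>
     (\<forall>x i f. (\<forall>j. C2 (\<lambda>y. f y j)) \<longrightarrow>
        (AE \<omega> in M. \<forall>t\<ge>0. set_integrable lborel {0..t}
            (\<lambda>s. switching_op b \<sigma> q f (X x i s \<omega>) (\<Lambda> x i s \<omega>)))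
      \<and> local_martingale M F (\<lambda>t \<omega>. f (X x i t \<omega>) (\<Lambda> x i t \<omega>) - f x i
            - (LINT s:{0..t}|lborel. switching_op b \<sigma> q f (X x i s \<omega>) (\<Lambda> x i s \<omega>))))"

section \<open>M-matrices\<close>

definition eigenvalues :: "real^'s^'s \<Rightarrow> complex set" where
  "eigenvalues A = {\<mu>. \<exists>v :: complex^'s. v \<noteq> 0 \<and>
     (\<chi> i j. complex_of_real (A $ i $ j)) *v v = \<mu> *s v}"

text \<open>The set of complex eigenvalues is finite and nonempty, so the supremum is a maximum.\<close>

definition spec_radius :: "real^'s^'s \<Rightarrow> real" where
  "spec_radius A = Sup (cmod ` eigenvalues A)"

definition M_matrix :: "real^'s^'s \<Rightarrow> bool" where
  "M_matrix A \<longleftrightarrow> (\<exists>\<gamma>>0. \<exists>N. (\<forall>i j. N $ i $ j \<ge> 0)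
     \<and> A = \<gamma> *\<^sub>R mat 1 - N \<and> spec_radius N \<le> \<gamma>)"

definition diag :: "real^'s \<Rightarrow> real^'s^'s" where
  "diag c = (\<chi> i j. if i = j then c $ i else 0)"

end

theory Submission
  imports Defs
begin

text \<open>The Lyapunov function is \<open>U(x) + \<beta>\<^sub>i \<phi>(W(x))\<close> with a nonnegative vector \<open>\<beta>\<close>.  In case (i),
  \<open>U = V\<close>, \<open>W = \<theta> \<circ> V\<close> and \<open>\<beta>\<close> solves the Poisson equation \<open>Q \<beta> + c = (\<lambda> \<bullet> c) 1\<close>, whose right-hand
  side is negative.  In case (iii), \<open>U = W = V\<close> and \<open>\<xi> = 1 + \<beta>\<close> is a positive vector with
  \<open>(Q + diag c) \<xi> < 0\<close>, which exists because the M-matrix is nonsingular.  In case (ii), the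
  function \<open>V powr p\<close> with small \<open>p > 0\<close> satisfies the condition of case (iii) with \<open>p c\<close> in place of
  \<open>c\<close>, where \<open>\<xi>\<close> is a perturbation of the vector 1 by \<open>p\<close> times the solution of the Poisson equation.

  The intensities \<open>q\<close> are controlled near infinity only and need not be locally bounded.  Therefore
  \<open>\<phi>\<close> is a \<open>C\<^sup>2\<close> ramp that vanishes up to a large level: the Lyapunov function does not depend on \<open>i\<close>
  where \<open>q\<close> is not controlled, and there the switching term is 0.\<close>

section \<open>Second-order calculus\<close>

lemma has_derivative_grad:
  assumes "f differentiable (at x)"
  shows "(f has_derivative (\<lambda>h. grad f x \<bullet> h)) (at x)"
proof -
  let ?D = "frechet_derivative f (at x)"
  have D: "(f has_derivative ?D) (at x)"
    using assms frechet_derivative_works by blast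
  then have lin: "linear ?D"
    using has_derivative_linear by blast
  have "?D h = grad f x \<bullet> h" for h
  proof -
    have "?D h = ?D (\<Sum>k\<in>UNIV. (h $ k) *\<^sub>R axis k 1)"
      using basis_expansion[of h] by (simp add: scalar_mult_eq_scaleR)
    also have "\<dots> = (\<Sum>k\<in>UNIV. h $ k * ?D (axis k 1))"
      by (simp add: linear_sum[OF lin] linear_scale[OF lin])
    also have "\<dots> = grad f x \<bullet> h"
      by (simp add: grad_def inner_vec_def mult.commute)
    finally show ?thesis .
  qed
  then have "?D = (\<lambda>h. grad f x \<bullet> h)" by blast
  with D show ?thesis by simp
qed

lemma grad_eqI:
  assumes "(f has_derivative (\<lambda>h. v \<bullet> h)) (at x)"
  shows "grad f x = v"
  by (simp add: grad_def vec_eq_iff inner_axis flip: frechet_derivative_at[OF assms])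

lemma has_derivative_hess:
  assumes "grad f differentiable (at x)"
  shows "(grad f has_derivative (\<lambda>h. hess f x *v h)) (at x)"
  using assms unfolding hess_def by (simp add: jacobian_works)

lemma hess_eqI:
  assumes "(grad f has_derivative (\<lambda>h. A *v h)) (at x)"
  shows "hess f x = A"
  using frechet_derivative_at[OF assms]
  by (metis hess_def jacobian_def matrix_of_matrix_vector_mul)

lemma C2D:
  assumes "C2 f"
  shows "(f has_derivative (\<lambda>h. grad f x \<bullet> h)) (at x)"
    and "(grad f has_derivative (\<lambda>h. hess f x *v h)) (at x)"
    and "continuous_on UNIV f" "continuous_on UNIV (grad f)" "continuous_on UNIV (hess f)"
  using assms unfolding C2_def
  by (auto simp: has_derivative_grad has_derivative_hess continuous_on_eq_continuous_at
      differentiable_imp_continuous_within)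

text \<open>\<open>grad\<close> and \<open>hess\<close> are defined through
  \<open>frechet_derivative\<close>, so they are computed by exhibiting candidates and invoking
  uniqueness of the derivative. Every later C2 computation goes through this rule.\<close>

lemma C2I:
  assumes f: "\<And>x. (f has_derivative (\<lambda>h. g x \<bullet> h)) (at x)"
    and g: "\<And>x. (g has_derivative (\<lambda>h. H x *v h)) (at x)"
    and H: "continuous_on UNIV H"
  shows "C2 f" "grad f = g" "hess f = H"
proof -
  show grad: "grad f = g"
    using f grad_eqI by blast
  show hess: "hess f = H"
    using g hess_eqI unfolding grad[symmetric] by blast
  show "C2 f"
    unfolding C2_def grad hess using f g H by (auto intro: differentiableI)
qed

lemma C2_add_scaled:
  assumes "C2 f" "C2 h"
  shows "C2 (\<lambda>x. f x + a * h x)"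
    and "grad (\<lambda>x. f x + a * h x) = (\<lambda>x. grad f x + a *\<^sub>R grad h x)"
    and "hess (\<lambda>x. f x + a * h x) = (\<lambda>x. hess f x + a *\<^sub>R hess h x)"
proof -
  have 1: "((\<lambda>x. f x + a * h x) has_derivative (\<lambda>k. (grad f x + a *\<^sub>R grad h x) \<bullet> k)) (at x)" for x
    by (rule derivative_eq_intros C2D(1)[OF assms(1)] C2D(1)[OF assms(2)] refl)+
       (simp add: inner_add_left)
  have 2: "((\<lambda>x. grad f x + a *\<^sub>R grad h x) has_derivative
      (\<lambda>k. (hess f x + a *\<^sub>R hess h x) *v k)) (at x)" for x
    by (rule derivative_eq_intros C2D(2)[OF assms(1)] C2D(2)[OF assms(2)] refl)+
       (simp add: matrix_vector_mult_add_rdistrib scaleR_matrix_vector_assoc)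
  have 3: "continuous_on UNIV (\<lambda>x. hess f x + a *\<^sub>R hess h x)"
    by (intro continuous_intros C2D(5) assms)
  show "C2 (\<lambda>x. f x + a * h x)"
    "grad (\<lambda>x. f x + a * h x) = (\<lambda>x. grad f x + a *\<^sub>R grad h x)"
    "hess (\<lambda>x. f x + a * h x) = (\<lambda>x. hess f x + a *\<^sub>R hess h x)"
    using C2I[OF 1 2 3] by blast+
qed

section \<open>Smooth functions on the half-line and the second-order chain rule\<close>

lemma C2_halflineI:
  assumes \<theta>: "\<And>u. u > 0 \<Longrightarrow> (\<theta> has_real_derivative \<theta>1 u) (at u)"
    and \<theta>1: "\<And>u. u > 0 \<Longrightarrow> (\<theta>1 has_real_derivative \<theta>2 u) (at u)"
    and cont: "continuous_on {0<..} \<theta>2"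
  shows "C2_halfline \<theta>"
    and "u > 0 \<Longrightarrow> deriv \<theta> u = \<theta>1 u"
    and "u > 0 \<Longrightarrow> deriv (deriv \<theta>) u = \<theta>2 u"
proof -
  have d1: "deriv \<theta> u = \<theta>1 u" if "u > 0" for u
    using \<theta>[OF that] DERIV_imp_deriv by blast
  \<comment> \<open>\<open>deriv \<theta>\<close> is known to agree with \<open>\<theta>1\<close>
    only for positive arguments, hence the transfer along the open half-line.\<close>
  have D2: "(deriv \<theta> has_real_derivative \<theta>2 u) (at u)" if "u > 0" for u
    by (rule has_field_derivative_transform_within_open[OF \<theta>1[OF that], of "{0<..}"])
       (use that d1 in auto)
  then have d2: "deriv (deriv \<theta>) u = \<theta>2 u" if "u > 0" for u
    using that DERIV_imp_deriv by blast
  have "continuous_on {0<..} (deriv (deriv \<theta>))"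
    using cont d2 by (subst continuous_on_cong[of _ "{0<..}" _ \<theta>2]) auto
  with \<theta> D2 show "C2_halfline \<theta>"
    unfolding C2_halfline_def by (auto simp: real_differentiable_def)
  show "u > 0 \<Longrightarrow> deriv \<theta> u = \<theta>1 u" "u > 0 \<Longrightarrow> deriv (deriv \<theta>) u = \<theta>2 u"
    using d1 d2 by auto
qed

lemma C2_halflineD:
  assumes "C2_halfline \<theta>" "u > 0"
  shows "(\<theta> has_real_derivative deriv \<theta> u) (at u)"
    and "(deriv \<theta> has_real_derivative deriv (deriv \<theta>) u) (at u)"
  using assms by (auto simp: C2_halfline_def DERIV_deriv_iff_real_differentiable)

lemma C2_compose:
  assumes \<theta>: "C2_halfline \<theta>" and V: "C2 V" and pos: "\<And>x. V x > 0"
  shows "C2 (\<lambda>x. \<theta> (V x))"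
    and "grad (\<lambda>x. \<theta> (V x)) = (\<lambda>x. deriv \<theta> (V x) *\<^sub>R grad V x)"
    and "hess (\<lambda>x. \<theta> (V x)) = (\<lambda>x. deriv \<theta> (V x) *\<^sub>R hess V x
      + deriv (deriv \<theta>) (V x) *\<^sub>R (\<chi> k l. grad V x $ k * grad V x $ l))"
proof -
  have 1: "((\<lambda>x. \<theta> (V x)) has_derivative (\<lambda>h. (deriv \<theta> (V x) *\<^sub>R grad V x) \<bullet> h)) (at x)" for x
    using has_derivative_compose[OF C2D(1)[OF V]
        C2_halflineD(1)[OF \<theta> pos, THEN has_field_derivative_imp_has_derivative]]
    by simp
  have 2: "((\<lambda>x. deriv \<theta> (V x)) has_derivative (\<lambda>h. deriv (deriv \<theta>) (V x) * (grad V x \<bullet> h))) (at x)"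
    for x
    using has_derivative_compose[OF C2D(1)[OF V]
        C2_halflineD(2)[OF \<theta> pos, THEN has_field_derivative_imp_has_derivative]]
    by simp
  \<comment> \<open>The rank-one matrix in the Hessian is the derivative of the scalar factor
    \<open>deriv \<theta> (V x)\<close> multiplied into the gradient.\<close>
  have outer: "(\<chi> k l. v $ k * v $ l) *v h = (v \<bullet> h) *\<^sub>R v" for v h :: "real^'a"
    by (simp add: vec_eq_iff matrix_vector_mult_def inner_vec_def sum_distrib_left ac_simps)
  have 3: "((\<lambda>x. deriv \<theta> (V x) *\<^sub>R grad V x) has_derivative
      (\<lambda>h. (deriv \<theta> (V x) *\<^sub>R hess V x
        + deriv (deriv \<theta>) (V x) *\<^sub>R (\<chi> k l. grad V x $ k * grad V x $ l)) *v h)) (at x)" for x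
    by (rule derivative_eq_intros 2 C2D(2)[OF V] refl)+
       (simp add: matrix_vector_mult_add_rdistrib outer flip: scaleR_matrix_vector_assoc)
  have cont1: "continuous_on UNIV (\<lambda>x. deriv \<theta> (V x))"
    using 2 by (auto simp: continuous_on_eq_continuous_at intro: has_derivative_continuous)
  have cont2: "continuous_on UNIV (\<lambda>x. deriv (deriv \<theta>) (V x))"
    by (rule continuous_on_compose2[OF _ C2D(3)[OF V], of "{0<..}"])
       (use \<theta> pos in \<open>auto simp: C2_halfline_def\<close>)
  have 4: "continuous_on UNIV (\<lambda>x. deriv \<theta> (V x) *\<^sub>R hess V x
        + deriv (deriv \<theta>) (V x) *\<^sub>R (\<chi> k l. grad V x $ k * grad V x $ l))"
    by (intro continuous_intros cont1 cont2 C2D(4,5)[OF V])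
  show "C2 (\<lambda>x. \<theta> (V x))"
    "grad (\<lambda>x. \<theta> (V x)) = (\<lambda>x. deriv \<theta> (V x) *\<^sub>R grad V x)"
    "hess (\<lambda>x. \<theta> (V x)) = (\<lambda>x. deriv \<theta> (V x) *\<^sub>R hess V x
      + deriv (deriv \<theta>) (V x) *\<^sub>R (\<chi> k l. grad V x $ k * grad V x $ l))"
    using C2I[OF 1 3 4] by blast+
qed

section \<open>The diffusion operator on sums and compositions\<close>

lemma trace_matrix_mult:
  fixes A :: "real^'m^'n"
  shows "trace (A ** H) = (\<Sum>k\<in>UNIV. \<Sum>l\<in>UNIV. A $ k $ l * H $ l $ k)"
  by (simp add: trace_def matrix_matrix_mult_def)

lemma diffusion_op_add_scaled:
  assumes "C2 f" "C2 h"
  shows "diffusion_op b \<sigma> i (\<lambda>x. f x + a * h x) x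
    = diffusion_op b \<sigma> i f x + a * diffusion_op b \<sigma> i h x"
  unfolding diffusion_op_def C2_add_scaled(2,3)[OF assms] trace_matrix_mult
  by (simp add: inner_add_right sum.distrib sum_distrib_left algebra_simps)

lemma diffusion_op_compose:
  assumes "C2_halfline \<theta>" "C2 V" "\<And>x. V x > 0"
  shows "diffusion_op b \<sigma> i (\<lambda>x. \<theta> (V x)) x = deriv \<theta> (V x) * diffusion_op b \<sigma> i V x
    + 1 / 2 * deriv (deriv \<theta>) (V x) * (norm (transpose (\<sigma> x i) *v grad V x))\<^sup>2"
proof -
  have quad: "(\<Sum>k\<in>UNIV. \<Sum>l\<in>UNIV. (S ** transpose S) $ k $ l * (v $ l * v $ k))
      = (norm (transpose S *v v))\<^sup>2" for S :: "real^'m::finite^'d::finite" and v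
  proof -
    have "(norm (transpose S *v v))\<^sup>2
        = (\<Sum>m\<in>UNIV. \<Sum>k\<in>UNIV. \<Sum>l\<in>UNIV. S $ k $ m * v $ k * (S $ l $ m * v $ l))"
      by (simp add: power2_norm_eq_inner inner_vec_def matrix_vector_mult_def transpose_def sum_product)
    also have "\<dots> = (\<Sum>k\<in>UNIV. \<Sum>l\<in>UNIV. \<Sum>m\<in>UNIV. S $ k $ m * v $ k * (S $ l $ m * v $ l))"
      by (subst sum.swap, rule sum.cong[OF refl], rule sum.swap)
    also have "\<dots> = (\<Sum>k\<in>UNIV. \<Sum>l\<in>UNIV. (S ** transpose S) $ k $ l * (v $ l * v $ k))"
      by (simp add: matrix_matrix_mult_def transpose_def sum_distrib_left sum_distrib_right ac_simps)
    finally show ?thesis by simp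
  qed
  show ?thesis
    unfolding diffusion_op_def C2_compose(2,3)[OF assms] trace_matrix_mult
    by (simp add: quad[symmetric] sum.distrib sum_distrib_left algebra_simps del: transpose_matrix_vector)
qed

section \<open>A twice continuously differentiable ramp\<close>

text \<open>Only the point 0 needs care: there the exponent \<open>n + 2\<close> bounds the
  difference quotient by a positive power of the increment. The cases \<open>n = 1\<close> and
  \<open>n = 0\<close> give the two derivatives of the truncated cube.\<close>

lemma max_power_has_real_derivative:
  "((\<lambda>t::real. max 0 t ^ (n + 2)) has_real_derivative real (n + 2) * max 0 t ^ (n + 1)) (at t)"
proof (cases "t = 0")
  case True
  have "((\<lambda>h::real. max 0 h ^ (n + 2) / h) \<longlongrightarrow> 0) (at 0)"
  proof (rule tendsto_0_le[where K = 1])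
    show "((\<lambda>h::real. h ^ (n + 1)) \<longlongrightarrow> 0) (at 0)"
      by (auto intro!: tendsto_eq_intros)
    show "\<forall>\<^sub>F h in at (0::real). norm (max 0 h ^ (n + 2) / h) \<le> norm (h ^ (n + 1)) * 1"
    proof (intro always_eventually allI)
      fix h :: real
      show "norm (max 0 h ^ (n + 2) / h) \<le> norm (h ^ (n + 1)) * 1"
        by (cases "0 \<le> h") (simp_all add: abs_mult mult_nonpos_nonneg)
    qed
  qed
  then show ?thesis
    using True by (simp add: DERIV_def)
next
  case False
  then consider "t > 0" | "t < 0" by linarith
  then show ?thesis
  proof cases
    case 1
    have "((\<lambda>t. t ^ (n + 2)) has_real_derivative real (n + 2) * t ^ (n + 1)) (at t)"
      by (rule derivative_eq_intros refl | simp)+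
    then have "((\<lambda>t. max 0 t ^ (n + 2)) has_real_derivative real (n + 2) * t ^ (n + 1)) (at t)"
      by (rule has_field_derivative_transform_within_open[of _ _ _ "{0<..}"]) (use 1 in auto)
    with 1 show ?thesis by simp
  next
    case 2
    have "((\<lambda>t. 0) has_real_derivative 0) (at t)" by simp
    then have "((\<lambda>t. max 0 t ^ (n + 2)) has_real_derivative 0) (at t)"
      by (rule has_field_derivative_transform_within_open[of _ _ _ "{..<0}"]) (use 2 in auto)
    with 2 show ?thesis by simp
  qed
qed

text \<open>The ramp is a multiple of the second difference of \<open>t \<mapsto> max 0 t ^ 3\<close>.\<close>

lemma C2_ramp:
  fixes K :: real
  obtains \<phi> where "C2_halfline \<phi>" "\<And>u. 0 \<le> \<phi> u" "\<And>u. u \<le> K \<Longrightarrow> \<phi> u = 0"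
    "\<And>u. K + 2 \<le> u \<Longrightarrow> \<phi> u = u - K - 1"
    "\<And>u. 0 < u \<Longrightarrow> K + 2 \<le> u \<Longrightarrow> deriv \<phi> u = 1"
    "\<And>u. 0 < u \<Longrightarrow> K + 2 \<le> u \<Longrightarrow> deriv (deriv \<phi>) u = 0"
proof -
  \<comment> \<open>\<open>d f\<close> is one sixth of the second difference, with nodes
    \<open>K\<close>, \<open>K + 1\<close>, \<open>K + 2\<close>, of the truncation of
    \<open>f\<close>. Taking \<open>f\<close> as an argument makes differentiation of
    \<open>d f\<close> amount to differentiation of \<open>f\<close>. For the cube the untruncated
    second difference is \<open>6 * (u - K - 1)\<close>, hence the divisor 6.\<close>
  define d where "d f u = (f (max 0 (u - K)) - 2 * f (max 0 (u - K - 1)) + f (max 0 (u - K - 2))) / 6"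
    for f :: "real \<Rightarrow> real" and u
  have shift: "((\<lambda>u. max 0 (u - a) ^ (n + 2)) has_real_derivative
      real (n + 2) * max 0 (u - a) ^ (n + 1)) (at u)" for a u :: real and n
    using DERIV_chain2[OF max_power_has_real_derivative, of "\<lambda>u. u - a" 1 u UNIV n]
    by (simp del: power_Suc power_add_numeral add_2_eq_Suc add_2_eq_Suc' add: DERIV_diff[where E = 0, simplified])
  have cube: "((\<lambda>u. max 0 (u - a) ^ 3) has_real_derivative 3 * max 0 (u - a) ^ 2) (at u)"
    for a u :: real
    using shift[of a 1 u] by (simp add: numeral_3_eq_3 numeral_2_eq_2)
  have square: "((\<lambda>u. 3 * max 0 (u - a) ^ 2) has_real_derivative 6 * max 0 (u - a)) (at u)"
    for a u :: real
    using DERIV_cmult[OF shift[of a 0 u], of 3] by (simp add: numeral_2_eq_2)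
  have D1: "(d (\<lambda>s. s ^ 3) has_real_derivative d (\<lambda>s. 3 * s ^ 2) u) (at u)" for u
    unfolding d_def diff_diff_eq by (rule DERIV_cdivide DERIV_add DERIV_diff DERIV_cmult cube)+
  have D2: "(d (\<lambda>s. 3 * s ^ 2) has_real_derivative d (\<lambda>s. 6 * s) u) (at u)" for u
    unfolding d_def diff_diff_eq by (rule square DERIV_cdivide DERIV_add DERIV_diff DERIV_cmult)+
  have cont: "continuous_on {0<..} (d (\<lambda>s. 6 * s))"
    unfolding d_def by (intro continuous_intros) auto
  note C = C2_halflineI[OF D1 D2 cont]
  show thesis
  proof
    show "C2_halfline (d (\<lambda>s. s ^ 3))" by (rule C)
    show "d (\<lambda>s. s ^ 3) u = 0" if "u \<le> K" for u
      using that by (simp add: d_def)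
    show eq: "d (\<lambda>s. s ^ 3) u = u - K - 1" if "K + 2 \<le> u" for u
      using that by (simp add: d_def field_simps power3_eq_cube)
    show "deriv (d (\<lambda>s. s ^ 3)) u = 1" if "0 < u" "K + 2 \<le> u" for u
      using that by (simp add: C d_def field_simps power2_eq_square)
    show "deriv (deriv (d (\<lambda>s. s ^ 3))) u = 0" if "0 < u" "K + 2 \<le> u" for u
      using that by (simp add: C d_def field_simps)
    show "0 \<le> d (\<lambda>s. s ^ 3) u" for u
    proof -
      consider "u - K \<le> 1" | "1 \<le> u - K" "u - K \<le> 2" | "K + 2 \<le> u" by linarith
      then show ?thesis
      proof cases
        case 1
        then show ?thesis by (simp add: d_def)
      next
        case 2
        define t where "t = u - K - 1"
        have t: "0 \<le> t" "t \<le> 1" "u - K = t + 1" using 2 by (auto simp: t_def)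
        \<comment> \<open>Between the first two nodes and the third, the last truncated term is 0,
          so nonnegativity reduces to this inequality; it holds because \<open>t ^ 3\<close> is at
          most 1.\<close>
        have "2 * t ^ 3 \<le> (t + 1) ^ 3"
        proof -
          have "t ^ 3 \<le> 1" using t by (simp add: power_le_one)
          moreover have "(t + 1) ^ 3 = t ^ 3 + 3 * t\<^sup>2 + 3 * t + 1"
            by (simp add: power3_eq_cube power2_eq_square algebra_simps)
          moreover have "0 \<le> t\<^sup>2" by simp
          ultimately show ?thesis using t by linarith
        qed
        with t show ?thesis by (simp add: d_def)
      next
        case 3
        then show ?thesis using eq by simp
      qed
    qed
  qed
qed

section \<open>Local bounds for the diffusion operator\<close>

lemma abs_nth_le_hs_norm: "\<bar>A $ k $ m\<bar> \<le> hs_norm A"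
proof -
  have "(A $ k $ m)\<^sup>2 \<le> (\<Sum>m\<in>UNIV. (A $ k $ m)\<^sup>2)"
    by (rule member_le_sum) auto
  also have "\<dots> \<le> (\<Sum>k\<in>UNIV. \<Sum>m\<in>UNIV. (A $ k $ m)\<^sup>2)"
    by (rule member_le_sum) (auto intro: sum_nonneg)
  also have "\<dots> = trace (A ** transpose A)"
    by (simp add: trace_matrix_mult transpose_def power2_eq_square)
  finally show ?thesis
    unfolding hs_norm_def by (metis real_sqrt_abs real_sqrt_le_mono)
qed

lemma bounded_continuous_image_ball:
  fixes f :: "'a::heine_borel \<Rightarrow> 'b::metric_space"
  assumes "continuous_on UNIV f"
  shows "bounded (f ` ball a r)"
proof -
  have "compact (f ` cball a r)"
    using assms by (intro compact_continuous_image) (auto intro: continuous_on_subset)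
  then show ?thesis
    using compact_imp_bounded bounded_subset image_mono ball_subset_cball by metis
qed

text \<open>Supplies the bound on the central ball, where no drift estimate is available. The
  entries of the coefficients are controlled by their norms, the derivatives of \<open>f\<close> by
  compactness.\<close>

lemma bounded_diffusion_op_ball:
  fixes b :: "real^'d \<Rightarrow> 's \<Rightarrow> real^'d" and \<sigma> :: "real^'d \<Rightarrow> 's \<Rightarrow> real^'n^'d"
  assumes coeff: "coefficients_locally_bounded b \<sigma>" and f: "C2 f"
  shows "\<exists>C. \<forall>x\<in>ball 0 r. \<bar>diffusion_op b \<sigma> i f x\<bar> \<le> C"
proof (cases "r > 0")
  case True
  then obtain A where A: "\<And>x. x \<in> ball 0 r \<Longrightarrow> norm (b x i) + hs_norm (\<sigma> x i) \<le> A"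
    using coeff unfolding coefficients_locally_bounded_def bdd_above_def by blast
  \<comment> \<open>Nonnegativity, read off from any entry, lets the bound on the sum of the two
    norms be split into a bound on each.\<close>
  have hs0: "0 \<le> hs_norm S" for S :: "real^'n^'d"
    using abs_nth_le_hs_norm[of S undefined undefined] by linarith
  obtain G where G: "\<And>x. x \<in> ball 0 r \<Longrightarrow> norm (grad f x) \<le> G"
    using bounded_continuous_image_ball[OF C2D(4)[OF f], of 0 r] unfolding bounded_iff by blast
  obtain H where H: "\<And>x. x \<in> ball 0 r \<Longrightarrow> norm (hess f x) \<le> H"
    using bounded_continuous_image_ball[OF C2D(5)[OF f], of 0 r] unfolding bounded_iff by blast
  have "\<bar>diffusion_op b \<sigma> i f x\<bar>
      \<le> A * G + 1 / 2 * (\<Sum>k\<in>(UNIV :: 'd set). \<Sum>l\<in>(UNIV :: 'd set). (\<Sum>m\<in>(UNIV :: 'n set). A * A) * H)"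
    if x: "x \<in> ball 0 r" for x
  proof -
    have b: "norm (b x i) \<le> A" and \<sigma>: "hs_norm (\<sigma> x i) \<le> A" and "0 \<le> A"
      using A[OF x] hs0[of "\<sigma> x i"] norm_ge_zero[of "b x i"] by linarith+
    have entry: "\<bar>\<sigma> x i $ k $ m\<bar> \<le> A" for k m
      using abs_nth_le_hs_norm \<sigma> order_trans by blast
    have Hentry: "\<bar>hess f x $ l $ k\<bar> \<le> H" for k l
      using H[OF x] Finite_Cartesian_Product.norm_nth_le[of "hess f x" l] Finite_Cartesian_Product.norm_nth_le[of "hess f x $ l" k] by simp
    have "\<bar>b x i \<bullet> grad f x\<bar> \<le> A * G"
      using Cauchy_Schwarz_ineq2[of "b x i" "grad f x"] mult_mono[OF b G[OF x]] \<open>0 \<le> A\<close> by simp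
    moreover have "\<bar>trace (\<sigma> x i ** transpose (\<sigma> x i) ** hess f x)\<bar>
        \<le> (\<Sum>k\<in>(UNIV :: 'd set). \<Sum>l\<in>(UNIV :: 'd set). (\<Sum>m\<in>(UNIV :: 'n set). A * A) * H)"
      unfolding trace_matrix_mult
      by (intro order_trans[OF sum_abs] sum_mono order_trans[OF sum_abs])
         (auto simp: abs_mult matrix_matrix_mult_def transpose_def
            intro!: mult_mono order_trans[OF sum_abs] sum_bounded_above entry Hentry \<open>0 \<le> A\<close>)
    ultimately show ?thesis
      unfolding diffusion_op_def by linarith
  qed
  then show ?thesis by blast
next
  case False
  then have "ball (0 :: real^'d) r = {}" by simp
  then show ?thesis by blast
qed

section \<open>Generators and M-matrices\<close>

lemma matrix_vector_mult_injective_surjective: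
  fixes A :: "real^'n^'n"
  assumes "\<And>x. A *v x = 0 \<Longrightarrow> x = 0"
  shows "\<exists>x. A *v x = y"
proof -
  obtain A' where "A ** A' = mat 1"
    using assms matrix_left_invertible_ker[of A] matrix_left_right_inverse by blast
  then have "A *v (A' *v y) = y"
    by (simp add: matrix_vector_mul_assoc)
  then show ?thesis by blast
qed

lemma finite_range_attains_max:
  fixes f :: "'a::finite \<Rightarrow> real"
  obtains m where "\<And>i. f i \<le> f m"
proof -
  have "Max (range f) \<in> range f" by simp
  then obtain m where "Max (range f) = f m" by blast
  then have "f i \<le> f m" for i
    using Max_ge[of "range f" "f i"] by simp
  then show thesis by (rule that)
qed

text \<open>Maximum principle along the paths given by irreducibility.\<close>

lemma irreducible_generator_kernel:
  fixes Q :: "real^'s::finite^'s"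
  assumes irr: "irreducible_generator Q"
    and nonneg: "\<And>i j. i \<noteq> j \<Longrightarrow> 0 \<le> Q $ i $ j"
    and rows: "\<And>i. (\<Sum>j\<in>UNIV. Q $ i $ j) = 0"
    and ker: "Q *v \<eta> = 0"
  shows "\<eta> $ i = \<eta> $ j"
proof -
  obtain m where m: "\<And>i. \<eta> $ i \<le> \<eta> $ m"
    using finite_range_attains_max[of "\<lambda>i. \<eta> $ i"] by blast
  have step: "\<eta> $ l = \<eta> $ m" if k: "\<eta> $ k = \<eta> $ m" and kl: "k \<noteq> l" "Q $ k $ l > 0" for k l
  proof -
    \<comment> \<open>At a maximum every summand is nonnegative; the diagonal one is 0 whatever the
      sign of \<open>Q $ k $ k\<close>. The sum is 0, so each summand is, and the maximum propagates
      to every \<open>l\<close> with a positive rate.\<close>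
    have nn: "0 \<le> Q $ k $ j * (\<eta> $ k - \<eta> $ j)" for j
      using nonneg[of k j] m[of j] k by (cases "k = j") auto
    have "(\<Sum>j\<in>UNIV. Q $ k $ j * (\<eta> $ k - \<eta> $ j))
        = (\<Sum>j\<in>UNIV. Q $ k $ j) * \<eta> $ k - (Q *v \<eta>) $ k"
      by (simp add: matrix_vector_mult_def algebra_simps sum_subtractf sum_distrib_left)
    also have "\<dots> = 0" by (simp add: rows ker)
    finally have "Q $ k $ l * (\<eta> $ k - \<eta> $ l) = 0"
      using nn by (simp add: sum_nonneg_eq_0_iff)
    with kl k show ?thesis by simp
  qed
  have all: "\<eta> $ j = \<eta> $ m" for j
  proof (cases "j = m")
    case False
    then obtain n and k :: "nat \<Rightarrow> 's" where k: "k 0 = m" "k n = j"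
      "\<And>l. l < n \<Longrightarrow> k l \<noteq> k (Suc l) \<and> Q $ k l $ k (Suc l) > 0"
      using irr[unfolded irreducible_generator_def, rule_format, of m j] by blast
    have "l \<le> n \<Longrightarrow> \<eta> $ k l = \<eta> $ m" for l
    proof (induction l)
      case 0
      show ?case by (simp only: k(1))
    next
      case (Suc l)
      then show ?case using step[of "k l" "k (Suc l)"] k(3)[of l] by simp
    qed
    from this[of n] show ?thesis by (simp only: k(2) order_refl)
  qed simp
  show ?thesis using all[of i] all[of j] by simp
qed

text \<open>\<open>A \<eta> = Q \<eta> - (\<mu> \<bullet> \<eta>) 1\<close> is injective, hence onto; pairing \<open>A \<eta> = - c\<close> with \<open>\<mu>\<close> gives
  \<open>Q \<eta> + c = (\<mu> \<bullet> c) 1\<close>.\<close>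

lemma poisson_equation:
  fixes Q :: "real^'s::finite^'s" and \<mu> c :: "real^'s"
  assumes irr: "irreducible_generator Q"
    and nonneg: "\<And>i j. i \<noteq> j \<Longrightarrow> 0 \<le> Q $ i $ j"
    and rows: "\<And>i. (\<Sum>j\<in>UNIV. Q $ i $ j) = 0"
    and inv: "\<mu> v* Q = 0" and one: "(\<Sum>i\<in>UNIV. \<mu> $ i) = 1"
  shows "\<exists>\<eta>. \<forall>i. (Q *v \<eta>) $ i + c $ i = \<mu> \<bullet> c"
proof -
  define A :: "real^'s^'s" where "A = Q - (\<chi> i j. \<mu> $ j)"
  have A: "(A *v \<eta>) $ i = (Q *v \<eta>) $ i - \<mu> \<bullet> \<eta>" for \<eta> i
    by (simp add: A_def matrix_vector_mult_def inner_vec_def left_diff_distrib sum_subtractf)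
  have "\<mu> \<bullet> (Q *v \<eta>) = 0" for \<eta>
    using inv by (simp flip: dot_lmul_matrix)
  then have pair: "(\<Sum>i\<in>UNIV. \<mu> $ i * (Q *v \<eta>) $ i) = 0" for \<eta>
    by (simp add: inner_vec_def)
  have \<mu>A: "\<mu> \<bullet> (A *v \<eta>) = - (\<mu> \<bullet> \<eta>)" for \<eta>
    by (simp add: inner_vec_def[of \<mu> "A *v \<eta>"] A right_diff_distrib sum_subtractf pair one
        flip: sum_distrib_right)
  \<comment> \<open>A kernel vector of \<open>A\<close> has \<open>\<mu>\<close>-mean 0, hence lies
    in the kernel of \<open>Q\<close> and is constant by irreducibility; a constant equals its
    mean.\<close>
  have "\<eta> = 0" if "A *v \<eta> = 0" for \<eta>
  proof -
    have 0: "\<mu> \<bullet> \<eta> = 0" using \<mu>A[of \<eta>] that by simp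
    then have "Q *v \<eta> = 0" using that A[of \<eta>] by (simp add: vec_eq_iff)
    then have const: "\<eta> $ i = \<eta> $ undefined" for i
      using irreducible_generator_kernel[OF irr nonneg rows] by blast
    have "(\<Sum>i\<in>UNIV. \<mu> $ i) * \<eta> $ undefined = \<mu> \<bullet> \<eta>"
      unfolding inner_vec_def sum_distrib_right
      by (rule sum.cong[OF refl]) (metis const inner_real_def)
    with 0 one have "\<eta> $ undefined = 0" by simp
    then show ?thesis using const by (simp add: vec_eq_iff)
  qed
  then obtain \<eta> where \<eta>: "A *v \<eta> = - c"
    using matrix_vector_mult_injective_surjective by metis
  have "\<mu> \<bullet> \<eta> = \<mu> \<bullet> c" using \<mu>A[of \<eta>] \<eta> by simp
  moreover have "(Q *v \<eta>) $ i + c $ i = \<mu> \<bullet> \<eta>" for i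
    using A[of \<eta> i] \<eta> by simp
  ultimately show ?thesis by metis
qed

section \<open>Generators and invariant measures of Markov chains\<close>

lemma infinitesimal_generator_nonneg:
  assumes gen: "infinitesimal_generator N Y Q" and "i \<noteq> j"
  shows "0 \<le> Q $ i $ j"
proof (rule tendsto_lowerbound)
  show "((\<lambda>t. \<P>(\<omega> in N. Y i t \<omega> = j) / t) \<longlongrightarrow> Q $ i $ j) (at_right 0)"
    using gen \<open>i \<noteq> j\<close> by (simp add: infinitesimal_generator_def)
  show "\<forall>\<^sub>F t in at_right 0. 0 \<le> \<P>(\<omega> in N. Y i t \<omega> = j) / t"
    using eventually_at_right_less[of 0] by eventually_elim simp
qed simp

lemma infinitesimal_generator_row_sum:
  assumes "infinitesimal_generator N Y Q"
  shows "(\<Sum>j\<in>UNIV. Q $ i $ j) = 0"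
  using assms by (simp add: infinitesimal_generator_def sum.remove[of UNIV i])

text \<open>For each \<open>t > 0\<close> invariance balances the mass entering \<open>j\<close>
  against the mass leaving it. Dividing by \<open>t\<close> and letting \<open>t\<close> tend to 0
  turns this balance into the stationary equation for \<open>Q\<close>.\<close>

lemma invariant_measure_generator:
  assumes mc: "markov_chain N Y" and gen: "infinitesimal_generator N Y Q"
    and inv: "invariant_measure N Y \<mu>"
  shows "(\<chi> i. pmf \<mu> i) v* Q = 0"
proof -
  interpret prob_space N using mc by (simp add: markov_chain_def)
  define p where "p t i j = \<P>(\<omega> in N. Y i t \<omega> = j)" for t i j
  have p1: "(\<Sum>j\<in>UNIV. p t i j) = 1" if "t \<ge> 0" for t i
  proof -
    have [measurable]: "Y i t \<in> N \<rightarrow>\<^sub>M count_space UNIV"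
      using mc that by (simp add: markov_chain_def)
    have "(\<Sum>j\<in>UNIV. p t i j) = prob (\<Union>j\<in>UNIV. {\<omega>\<in>space N. Y i t \<omega> = j})"
      unfolding p_def by (rule finite_measure_finite_Union[symmetric]) (auto simp: disjoint_family_on_def)
    also have "(\<Union>j\<in>UNIV. {\<omega>\<in>space N. Y i t \<omega> = j}) = space N" by auto
    finally show ?thesis by (simp add: prob_space)
  qed
  have "(\<Sum>i\<in>UNIV. pmf \<mu> i * Q $ i $ j) = 0" for j
  proof -
    have lim: "((\<lambda>t. p t i k / t) \<longlongrightarrow> Q $ i $ k) (at_right 0)" if "i \<noteq> k" for i k
      using gen that by (simp add: infinitesimal_generator_def p_def)
    \<comment> \<open>Since each row of \<open>p t\<close> sums to 1, the term with
      \<open>p t j j\<close> cancels; only off-diagonal entries remain, and these are the ones whose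
      limits the generator provides.\<close>
    have bal: "(\<Sum>i\<in>UNIV - {j}. pmf \<mu> i * (p t i j / t)) = pmf \<mu> j * (\<Sum>k\<in>UNIV - {j}. p t j k / t)"
      if "t > 0" for t
    proof -
      have "(\<Sum>i\<in>UNIV. pmf \<mu> i * p t i j) = pmf \<mu> j * (\<Sum>k\<in>UNIV. p t j k)"
        using inv that p1[of t j] by (simp add: invariant_measure_def p_def)
      then have "(\<Sum>i\<in>UNIV - {j}. pmf \<mu> i * p t i j) = pmf \<mu> j * (\<Sum>k\<in>UNIV - {j}. p t j k)"
        by (simp add: sum.remove[of UNIV j] distrib_left)
      then show ?thesis
        by (simp flip: sum_divide_distrib)
    qed
    have "((\<lambda>t. \<Sum>i\<in>UNIV - {j}. pmf \<mu> i * (p t i j / t)) \<longlongrightarrow>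
        (\<Sum>i\<in>UNIV - {j}. pmf \<mu> i * Q $ i $ j)) (at_right 0)"
      by (intro tendsto_intros lim) auto
    moreover have "((\<lambda>t. pmf \<mu> j * (\<Sum>k\<in>UNIV - {j}. p t j k / t)) \<longlongrightarrow>
        pmf \<mu> j * (\<Sum>k\<in>UNIV - {j}. Q $ j $ k)) (at_right 0)"
      by (intro tendsto_intros lim) auto
    then have "((\<lambda>t. \<Sum>i\<in>UNIV - {j}. pmf \<mu> i * (p t i j / t)) \<longlongrightarrow>
        pmf \<mu> j * (\<Sum>k\<in>UNIV - {j}. Q $ j $ k)) (at_right 0)"
      by (rule Lim_transform_eventually)
         (use eventually_at_right_less[of 0] in eventually_elim, simp only: bal)
    ultimately have "(\<Sum>i\<in>UNIV - {j}. pmf \<mu> i * Q $ i $ j) = pmf \<mu> j * (\<Sum>k\<in>UNIV - {j}. Q $ j $ k)"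
      by (rule tendsto_unique[rotated]) simp
    then show ?thesis
      using gen by (simp add: sum.remove[of UNIV j] infinitesimal_generator_def)
  qed
  then show ?thesis
    by (simp add: vec_eq_iff vector_matrix_mult_def mult.commute)
qed

text \<open>The constant in the Poisson equation is the mean of \<open>c\<close>, which is negative.
  Adding a multiple of the vector 1 does not change \<open>Q *v \<eta>\<close> because the rows sum
  to 0, so \<open>\<eta>\<close> can be shifted by its norm to become nonnegative.\<close>

lemma invariant_measure_subharmonic:
  fixes c :: "real^'s::finite"
  assumes "markov_chain N Y" and gen: "infinitesimal_generator N Y Q"
    and irr: "irreducible_generator Q" and "invariant_measure N Y \<mu>"
    and neg: "(\<Sum>i\<in>UNIV. c $ i * pmf \<mu> i) < 0"
  shows "\<exists>\<eta> \<kappa>. \<kappa> > 0 \<and> (\<forall>i. \<eta> $ i \<ge> 0 \<and> (Q *v \<eta>) $ i + c $ i = - \<kappa>)"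
proof -
  note rows = infinitesimal_generator_row_sum[OF gen]
  let ?\<mu> = "\<chi> i. pmf \<mu> i"
  have "(\<Sum>i\<in>UNIV. ?\<mu> $ i) = 1"
    by (simp add: sum_pmf_eq_1)
  then obtain \<eta> where \<eta>: "\<And>i. (Q *v \<eta>) $ i + c $ i = ?\<mu> \<bullet> c"
    using poisson_equation[OF irr infinitesimal_generator_nonneg[OF gen] rows
        invariant_measure_generator[OF assms(1,2,4)]] by blast
  have "?\<mu> \<bullet> c < 0" using neg by (simp add: inner_vec_def mult.commute)
  moreover have "(Q *v (\<eta> + a *\<^sub>R 1)) $ i = (Q *v \<eta>) $ i" for a i
    using rows[of i]
    by (simp add: matrix_vector_mult_def distrib_left sum.distrib flip: sum_distrib_right)
  moreover have "(\<eta> + norm \<eta> *\<^sub>R 1) $ i \<ge> 0" for i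
    using component_le_norm_cart[of \<eta> i] by simp
  ultimately show ?thesis
    using \<eta> by (intro exI[of _ "\<eta> + norm \<eta> *\<^sub>R 1"] exI[of _ "- (?\<mu> \<bullet> c)"]) simp
qed

section \<open>Spectral radius and positive vectors of M-matrices\<close>

text \<open>The eigenvalue equation is read at a coordinate of largest modulus. The bound itself is
  crude; it serves to make the supremum in \<open>spec_radius\<close> an upper bound.\<close>

lemma norm_le_of_mem_eigenvalues:
  assumes "\<mu> \<in> eigenvalues A"
  shows "norm \<mu> \<le> (\<Sum>i\<in>UNIV. \<Sum>j\<in>UNIV. \<bar>A $ i $ j\<bar>)"
proof -
  obtain v :: "complex^'a" where v: "v \<noteq> 0"
    "(\<chi> i j. complex_of_real (A $ i $ j)) *v v = \<mu> *s v"
    using assms by (auto simp: eigenvalues_def)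
  obtain m where m: "\<And>i. norm (v $ i) \<le> norm (v $ m)"
    using finite_range_attains_max[of "\<lambda>i. norm (v $ i)"] by blast
  have pos: "norm (v $ m) > 0"
  proof (rule ccontr)
    assume "\<not> norm (v $ m) > 0"
    with m have "norm (v $ i) \<le> 0" for i by (metis linorder_not_less order_trans)
    with v show False by (simp add: vec_eq_iff)
  qed
  have "\<mu> * v $ m = (\<Sum>j\<in>UNIV. complex_of_real (A $ m $ j) * v $ j)"
    using arg_cong[OF v(2), of "\<lambda>w. w $ m"] by (simp add: matrix_vector_mult_def)
  then have "norm \<mu> * norm (v $ m) = norm (\<Sum>j\<in>UNIV. complex_of_real (A $ m $ j) * v $ j)"
    by (simp flip: norm_mult)
  also have "\<dots> \<le> (\<Sum>j\<in>UNIV. \<bar>A $ m $ j\<bar> * norm (v $ m))"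
    by (intro order_trans[OF norm_sum] sum_mono) (simp add: norm_mult m mult_left_mono)
  also have "\<dots> = (\<Sum>j\<in>UNIV. \<bar>A $ m $ j\<bar>) * norm (v $ m)"
    by (simp add: sum_distrib_right)
  finally have "norm \<mu> \<le> (\<Sum>j\<in>UNIV. \<bar>A $ m $ j\<bar>)"
    using pos by simp
  also have "\<dots> \<le> (\<Sum>i\<in>UNIV. \<Sum>j\<in>UNIV. \<bar>A $ i $ j\<bar>)"
    by (rule member_le_sum) (auto intro: sum_nonneg)
  finally show ?thesis .
qed

lemma real_eigenvalue_le_spec_radius:
  fixes A :: "real^'s^'s"
  assumes "A *v v = r *\<^sub>R v" "v \<noteq> 0"
  shows "\<bar>r\<bar> \<le> spec_radius A"
proof -
  define w :: "complex^'s" where "w = (\<chi> i. complex_of_real (v $ i))"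
  have "w \<noteq> 0" using assms(2) by (simp add: w_def vec_eq_iff)
  moreover have "(\<chi> i j. complex_of_real (A $ i $ j)) *v w = complex_of_real r *s w"
    using assms(1)
    by (simp add: w_def vec_eq_iff matrix_vector_mult_def flip: of_real_mult of_real_sum)
  ultimately have "complex_of_real r \<in> eigenvalues A"
    unfolding eigenvalues_def by blast
  moreover have "bdd_above (cmod ` eigenvalues A)"
    by (rule bdd_aboveI[of _ "\<Sum>i\<in>UNIV. \<Sum>j\<in>UNIV. \<bar>A $ i $ j\<bar>"])
       (auto intro: norm_le_of_mem_eigenvalues)
  ultimately have "cmod (complex_of_real r) \<le> spec_radius A"
    unfolding spec_radius_def by (intro cSup_upper imageI)
  then show ?thesis by simp
qed

lemma continuous_on_det:
  fixes A :: "'a::topological_space \<Rightarrow> real^'n^'n"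
  assumes "\<And>i j. continuous_on S (\<lambda>t. A t $ i $ j)"
  shows "continuous_on S (\<lambda>t. det (A t))"
  unfolding det_def by (intro continuous_intros assms)

text \<open>The solution \<open>\<xi> t\<close> of \<open>((\<gamma> + t) I - N) \<xi> = 1\<close> depends continuously on \<open>t \<ge> 0\<close> and is
  positive as soon as it is nonnegative, so the set of \<open>t\<close> with \<open>\<xi> t > 0\<close> is open and closed.  For
  large \<open>t\<close> the matrix is diagonally dominant and \<open>\<xi> t\<close> is positive.\<close>

lemma M_matrix_positive_vector:
  fixes A :: "real^'s::finite^'s"
  assumes M: "M_matrix A" and inv: "invertible A"
  shows "\<exists>\<xi>. \<forall>i. \<xi> $ i > 0 \<and> (A *v \<xi>) $ i > 0"
proof -
  obtain \<gamma> N where \<gamma>: "\<gamma> > 0" and N: "\<And>i j. N $ i $ j \<ge> 0"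
    and A: "A = \<gamma> *\<^sub>R mat 1 - N" and \<rho>: "spec_radius N \<le> \<gamma>"
    using M unfolding M_matrix_def by blast
  define B where "B t = (\<gamma> + t) *\<^sub>R mat 1 - N" for t
  have Bv: "(B t *v v) $ i = (\<gamma> + t) * v $ i - (N *v v) $ i" for t v i
    by (simp add: B_def matrix_vector_mult_diff_rdistrib flip: scaleR_matrix_vector_assoc)
  \<comment> \<open>At \<open>t = 0\<close> this is the assumed invertibility; for
    \<open>t > 0\<close> a kernel vector would make \<open>\<gamma> + t\<close> an eigenvalue of
    \<open>N\<close> beyond the spectral radius.\<close>
  have detB: "det (B t) \<noteq> 0" if "t \<ge> 0" for t
  proof (cases "t = 0")
    case True
    with inv show ?thesis by (simp add: A B_def invertible_det_nz)
  next
    case False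
    have "v = 0" if v: "B t *v v = 0" for v
    proof (rule ccontr)
      assume "v \<noteq> 0"
      moreover have "N *v v = (\<gamma> + t) *\<^sub>R v"
        using v Bv[of t v] by (simp add: vec_eq_iff)
      ultimately have "\<bar>\<gamma> + t\<bar> \<le> spec_radius N"
        by (rule real_eigenvalue_le_spec_radius[rotated])
      with False that \<open>t \<ge> 0\<close> \<gamma> \<rho> show False by linarith
    qed
    then show ?thesis
      by (metis invertible_det_nz invertible_left_inverse matrix_left_invertible_ker)
  qed
  \<comment> \<open>Cramer's rule gives the solution as a quotient of determinants, from which
    continuity in \<open>t\<close> is immediate.\<close>
  define \<xi> :: "real \<Rightarrow> real^'s" where
    "\<xi> t = (\<chi> k. det (\<chi> i j. if j = k then 1 $ i else B t $ i $ j) / det (B t))" for t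
  have B\<xi>: "B t *v \<xi> t = 1" if "t \<ge> 0" for t
    using cramer[OF detB[OF that], of "\<xi> t" 1] by (simp add: \<xi>_def)
  have cont: "continuous_on {0..} (\<lambda>t. \<xi> t $ k)" for k
  proof -
    have entry: "continuous_on {0..} (\<lambda>t. B t $ i $ j)" for i j
      unfolding B_def by (auto simp: mat_def intro!: continuous_intros)
    have "continuous_on {0..} (\<lambda>t. if j = k then 1 $ i else B t $ i $ j)" for i j
      using entry by (cases "j = k") auto
    then show ?thesis
      unfolding \<xi>_def vec_lambda_beta
      by (intro continuous_on_divide continuous_on_det) (use detB entry in auto)
  qed
  \<comment> \<open>In coordinates the equation reads
    \<open>(\<gamma> + t) * \<xi> t $ k = 1 + (N *v \<xi> t) $ k\<close>, whose right-hand side is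
    at least 1.\<close>
  have pos: "\<xi> t $ k > 0" if t: "t \<ge> 0" and nn: "\<And>i. \<xi> t $ i \<ge> 0" for t k
  proof -
    have "0 \<le> (N *v \<xi> t) $ k"
      unfolding matrix_vector_mult_def by (auto intro!: sum_nonneg simp: N nn)
    then have "(\<gamma> + t) * \<xi> t $ k > 0"
      using Bv[of t "\<xi> t" k] B\<xi>[OF t] by simp
    with t \<gamma> show ?thesis by (simp add: zero_less_mult_iff)
  qed
  \<comment> \<open>The total of all entries of \<open>N\<close> dominates every row sum. Reading
    the equation in the row of the smallest component of \<open>\<xi> T\<close> then shows that this
    component is positive.\<close>
  define T where "T = (\<Sum>i\<in>UNIV. \<Sum>j\<in>UNIV. N $ i $ j)"
  have T: "T \<ge> 0" unfolding T_def by (intro sum_nonneg N)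
  have large: "\<xi> T $ k \<ge> 0" for k
  proof -
    obtain m where m: "\<And>i. \<xi> T $ m \<le> \<xi> T $ i"
      using finite_range_attains_max[of "\<lambda>i. - \<xi> T $ i"] by (metis neg_le_iff_le)
    have row: "(\<Sum>j\<in>UNIV. N $ m $ j) \<le> T"
      unfolding T_def by (rule member_le_sum) (auto intro: sum_nonneg N)
    have "(\<Sum>j\<in>UNIV. N $ m $ j) * \<xi> T $ m \<le> (N *v \<xi> T) $ m"
      unfolding matrix_vector_mult_def sum_distrib_right
      by (auto intro!: sum_mono mult_left_mono m N)
    then have "(\<gamma> + T - (\<Sum>j\<in>UNIV. N $ m $ j)) * \<xi> T $ m > 0"
      using Bv[of T "\<xi> T" m] B\<xi>[OF T] by (simp add: left_diff_distrib)
    then have "\<xi> T $ m > 0"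
      using row \<gamma> by (simp add: zero_less_mult_iff)
    then show ?thesis using m[of k] by linarith
  qed
  let ?S = "{t\<in>{0..}. \<forall>k. \<xi> t $ k \<ge> 0}"
  have "closedin (top_of_set {0..}) ?S"
  proof -
    have "?S = (\<Inter>k. {t\<in>{0..}. \<xi> t $ k \<in> {0..}})" by auto
    also have "closedin (top_of_set {0..}) \<dots>"
      using continuous_closedin_preimage[OF cont, of "{0..}"]
      by (intro closedin_INT) (auto simp: vimage_def Int_def)
    finally show ?thesis .
  qed
  moreover have "openin (top_of_set {0..}) ?S"
  proof -
    have "?S = (\<Inter>k. {t\<in>{0..}. \<xi> t $ k \<in> {0<..}})"
      using pos by (auto intro: less_imp_le)
    also have "openin (top_of_set {0..}) \<dots>"
      using continuous_openin_preimage_gen[OF cont, of "{0<..}"]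
      by (intro openin_INT2) (auto simp: vimage_def Int_def)
    finally show ?thesis .
  qed
  moreover have "connected {0::real..}"
    by (simp add: convex_connected)
  ultimately have "?S = {0..}"
    using large T by (auto simp: connected_clopen)
  then have "\<xi> 0 $ k > 0" for k
    using pos[of 0 k] by auto
  moreover have "A *v \<xi> 0 = 1" using B\<xi>[of 0] by (simp add: A B_def)
  ultimately show ?thesis by (intro exI[of _ "\<xi> 0"]) simp
qed

section \<open>Lyapunov functions\<close>

text \<open>All three cases end here. Far out the ramp is \<open>W\<close> minus a constant, so half
  of the drift \<open>\<epsilon> * W\<close> absorbs the error \<open>q x - Q\<close> and the other
  half, up to a constant, becomes \<open>g\<close>. On the remaining ball an upper bound
  suffices.\<close>

lemma lyapunov_function_of_drift:
  fixes b :: "real^'d::finite \<Rightarrow> 's::finite \<Rightarrow> real^'d" and \<sigma> :: "real^'d \<Rightarrow> 's \<Rightarrow> real^'n::finite^'d"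
    and q :: "real^'d \<Rightarrow> real^'s^'s" and \<beta> :: "real^'s"
  assumes coeff: "coefficients_locally_bounded b \<sigma>"
    and rows: "\<And>x i. (\<Sum>j\<in>UNIV. q x $ i $ j) = 0"
    and Q_limit: "((\<lambda>x. q x - Q) \<longlongrightarrow> 0) at_infinity"
    and U: "C2 U" "\<And>x. 0 \<le> U x"
    and W: "C2 W" "\<And>x. 0 < W x" "filterlim W at_top at_infinity"
    and \<beta>: "\<And>i. 0 \<le> \<beta> $ i" and \<epsilon>: "0 < \<epsilon>"
    and drift: "\<forall>\<^sub>F x in at_infinity. \<forall>i. diffusion_op b \<sigma> i U x + \<beta> $ i * diffusion_op b \<sigma> i W x
      + W x * (Q *v \<beta>) $ i \<le> - \<epsilon> * W x"
  shows "\<exists>(\<V> :: real^'d \<Rightarrow> 's \<Rightarrow> real) (g :: real^'d \<Rightarrow> real).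
      (\<forall>x i. \<V> x i \<ge> 0) \<and> (\<forall>i. C2 (\<lambda>x. \<V> x i)) \<and> locally_bounded g
      \<and> filterlim g at_top at_infinity
      \<and> (\<forall>x i. switching_op b \<sigma> q \<V> x i \<le> - g x)"
proof -
  define S where "S = (\<Sum>j\<in>UNIV. \<beta> $ j)"
  have S: "0 \<le> S" unfolding S_def by (intro sum_nonneg \<beta>)
  have close: "\<forall>\<^sub>F x in at_infinity. \<forall>i. \<bar>((q x - Q) *v \<beta>) $ i\<bar> \<le> \<delta>" if "\<delta> > 0" for \<delta>
  proof -
    \<comment> \<open>The entries of \<open>q x - Q\<close> are multiplied by the weights
      \<open>\<beta>\<close> with total \<open>S\<close>; the summand 1 covers
      \<open>S = 0\<close>.\<close>
    have "\<delta> / (S + 1) > 0" using that S by simp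
    from tendstoD[OF Q_limit this] show ?thesis
    proof eventually_elim
      case (elim x)
      have entry: "\<bar>(q x - Q) $ i $ j\<bar> \<le> \<delta> / (S + 1)" for i j
        using elim Finite_Cartesian_Product.norm_nth_le[of "q x - Q" i]
          Finite_Cartesian_Product.norm_nth_le[of "(q x - Q) $ i" j] by simp
      show ?case
      proof
        fix i
        have "\<bar>((q x - Q) *v \<beta>) $ i\<bar> \<le> (\<Sum>j\<in>UNIV. \<delta> / (S + 1) * \<beta> $ j)"
          unfolding matrix_vector_mult_def vec_lambda_beta
          by (intro order_trans[OF sum_abs] sum_mono)
             (use mult_right_mono[OF entry \<beta>] in \<open>simp add: abs_mult \<beta>\<close>)
        also have "\<dots> = \<delta> / (S + 1) * S" by (simp add: S_def sum_distrib_left)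
        also have "\<dots> \<le> \<delta>" using S that by (simp add: field_simps)
        finally show "\<bar>((q x - Q) *v \<beta>) $ i\<bar> \<le> \<delta>" .
      qed
    qed
  qed
  obtain R where R: "\<And>x i. R \<le> norm x \<Longrightarrow> \<bar>((q x - Q) *v \<beta>) $ i\<bar> \<le> 1"
    using close[of 1] unfolding eventually_at_infinity by auto
  define D where "D = norm (Q *v \<beta>) + 1"
  have D: "\<bar>(q x *v \<beta>) $ i\<bar> \<le> D" if "R \<le> norm x" for x i
    using R[OF that, of i] component_le_norm_cart[of "Q *v \<beta>" i]
    by (simp add: D_def matrix_vector_mult_diff_rdistrib)
  have D0: "0 \<le> D" by (simp add: D_def)
  obtain K0 where K0: "\<And>x. x \<in> ball 0 R \<Longrightarrow> norm (W x) \<le> K0"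
    using bounded_continuous_image_ball[OF C2D(3)[OF W(1)], of 0 R] unfolding bounded_iff by blast
  \<comment> \<open>Below the level \<open>K\<close> the ramp vanishes, which covers the ball where
    \<open>q\<close> is not controlled. The absolute value makes \<open>K\<close> nonnegative also
    when that ball is empty and \<open>K0\<close> arbitrary.\<close>
  define K where "K = \<bar>K0\<bar>"
  have K: "0 \<le> K" "\<And>x. norm x < R \<Longrightarrow> W x \<le> K"
    using K0 by (force simp: K_def)+
  obtain \<phi> where \<phi>: "C2_halfline \<phi>" "\<And>u. 0 \<le> \<phi> u" "\<And>u. u \<le> K \<Longrightarrow> \<phi> u = 0"
    "\<And>u. K + 2 \<le> u \<Longrightarrow> \<phi> u = u - K - 1"
    "\<And>u. 0 < u \<Longrightarrow> K + 2 \<le> u \<Longrightarrow> deriv \<phi> u = 1"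
    "\<And>u. 0 < u \<Longrightarrow> K + 2 \<le> u \<Longrightarrow> deriv (deriv \<phi>) u = 0"
    using C2_ramp[of K] by metis
  note C2\<phi> = C2_compose(1)[OF \<phi>(1) W(1,2)]
  define \<V> where "\<V> x i = U x + \<beta> $ i * \<phi> (W x)" for x i
  \<comment> \<open>\<open>U\<close> does not depend on the regime and the rows of
    \<open>q x\<close> sum to 0, so only the ramp part enters the switching term.\<close>
  have op: "switching_op b \<sigma> q \<V> x i = diffusion_op b \<sigma> i U x
      + \<beta> $ i * diffusion_op b \<sigma> i (\<lambda>x. \<phi> (W x)) x + \<phi> (W x) * (q x *v \<beta>) $ i" for x i
  proof -
    have "(\<Sum>j\<in>UNIV. \<V> x j * q x $ i $ j)
        = U x * (\<Sum>j\<in>UNIV. q x $ i $ j) + \<phi> (W x) * (q x *v \<beta>) $ i"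
      by (simp add: \<V>_def matrix_vector_mult_def sum.distrib sum_distrib_left algebra_simps)
    then show ?thesis
      by (simp add: switching_op_def \<V>_def[abs_def] rows diffusion_op_add_scaled[OF U(1) C2\<phi>])
  qed
  have upper: "\<exists>C. \<forall>x\<in>ball 0 r. \<forall>i. switching_op b \<sigma> q \<V> x i \<le> C" for r
  proof -
    obtain A1 where A1: "\<And>i x. x \<in> ball 0 r \<Longrightarrow> \<bar>diffusion_op b \<sigma> i U x\<bar> \<le> A1 i"
      using bounded_diffusion_op_ball[OF coeff U(1)] by metis
    obtain A2 where A2: "\<And>i x. x \<in> ball 0 r \<Longrightarrow> \<bar>diffusion_op b \<sigma> i (\<lambda>x. \<phi> (W x)) x\<bar> \<le> A2 i"
      using bounded_diffusion_op_ball[OF coeff C2\<phi>] by metis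
    obtain E where E: "\<And>x. x \<in> ball 0 r \<Longrightarrow> norm (\<phi> (W x)) \<le> E"
      using bounded_continuous_image_ball[OF C2D(3)[OF C2\<phi>], of 0 r] unfolding bounded_iff by blast
    have "switching_op b \<sigma> q \<V> x i \<le> (\<Sum>i\<in>UNIV. \<bar>A1 i\<bar> + \<beta> $ i * \<bar>A2 i\<bar>) + E * D"
      if x: "x \<in> ball 0 r" for x i
    proof -
      have "diffusion_op b \<sigma> i U x + \<beta> $ i * diffusion_op b \<sigma> i (\<lambda>x. \<phi> (W x)) x
          \<le> \<bar>A1 i\<bar> + \<beta> $ i * \<bar>A2 i\<bar>"
        using A1[OF x, of i] A2[OF x, of i] \<beta>[of i] by (intro add_mono mult_left_mono) auto
      also have "\<dots> \<le> (\<Sum>i\<in>UNIV. \<bar>A1 i\<bar> + \<beta> $ i * \<bar>A2 i\<bar>)"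
        by (rule member_le_sum) (auto simp: \<beta>)
      finally have 1: "diffusion_op b \<sigma> i U x + \<beta> $ i * diffusion_op b \<sigma> i (\<lambda>x. \<phi> (W x)) x
          \<le> (\<Sum>i\<in>UNIV. \<bar>A1 i\<bar> + \<beta> $ i * \<bar>A2 i\<bar>)" .
      \<comment> \<open>Inside radius \<open>R\<close> the ramp is 0 whatever \<open>q\<close> is;
        outside, \<open>D\<close> bounds the switching rates acting on
        \<open>\<beta>\<close>.\<close>
      have 2: "\<phi> (W x) * (q x *v \<beta>) $ i \<le> E * D"
      proof (cases "norm x < R")
        case True
        then show ?thesis using K(2)[of x] \<phi>(3)[of "W x"] E[OF x] D0 by simp
      next
        case False
        then show ?thesis
          using D[of x i] E[OF x] \<phi>(2)[of "W x"] D0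
          by (intro order_trans[OF mult_left_mono[of _ D] mult_right_mono]) auto
      qed
      show ?thesis unfolding op using 1 2 by linarith
    qed
    then show ?thesis by blast
  qed
  have "\<forall>\<^sub>F x in at_infinity. \<forall>i. switching_op b \<sigma> q \<V> x i \<le> (K + 1) * D - \<epsilon> / 2 * W x"
  proof -
    have far: "\<forall>\<^sub>F x in at_infinity. R \<le> norm (x :: real^'d)"
      unfolding eventually_at_infinity by blast
    have big: "\<forall>\<^sub>F x in at_infinity. K + 2 \<le> W x"
      using W(3) by (simp add: filterlim_at_top)
    have "\<epsilon> / 2 > 0" using \<epsilon> by simp
    from drift close[OF this] far big show ?thesis
    proof eventually_elim
      case (elim x)
      show ?case
      proof
        fix i
        have W\<phi>: "diffusion_op b \<sigma> i (\<lambda>x. \<phi> (W x)) x = diffusion_op b \<sigma> i W x"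
          unfolding diffusion_op_compose[OF \<phi>(1) W(1,2)] using elim(4) W(2)[of x] by (simp add: \<phi>(5,6))
        have "W x * ((q x - Q) *v \<beta>) $ i \<le> W x * (\<epsilon> / 2)"
          using elim(2)[rule_format, of i] W(2)[of x] by (intro mult_left_mono) auto
        then have 1: "W x * (q x *v \<beta>) $ i \<le> W x * (Q *v \<beta>) $ i + W x * (\<epsilon> / 2)"
          by (simp add: matrix_vector_mult_diff_rdistrib algebra_simps)
        \<comment> \<open>This is the cost of replacing the ramp value \<open>W x - K - 1\<close> by
          \<open>W x\<close> in the switching term.\<close>
        have "(K + 1) * - (q x *v \<beta>) $ i \<le> (K + 1) * D"
          using D[OF elim(3), of i] K(1) by (intro mult_left_mono) auto
        with 1 have "\<phi> (W x) * (q x *v \<beta>) $ i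
            \<le> W x * (Q *v \<beta>) $ i + W x * (\<epsilon> / 2) + (K + 1) * D"
          by (simp add: \<phi>(4)[OF elim(4)] algebra_simps)
        then show "switching_op b \<sigma> q \<V> x i \<le> (K + 1) * D - \<epsilon> / 2 * W x"
          unfolding op W\<phi> using elim(1)[rule_format, of i] by (simp add: algebra_simps)
      qed
    qed
  qed
  then obtain r where r: "\<And>x i. r \<le> norm x \<Longrightarrow>
      switching_op b \<sigma> q \<V> x i \<le> (K + 1) * D - \<epsilon> / 2 * W x"
    unfolding eventually_at_infinity by blast
  obtain C where C: "\<And>x i. norm x < r \<Longrightarrow> switching_op b \<sigma> q \<V> x i \<le> C"
    using upper[of r] by (metis mem_ball_0)
  \<comment> \<open>The two bounds are glued along a sphere. A jump there is harmless, since local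
    boundedness is what \<open>g\<close> must satisfy.\<close>
  define g where "g x = (if norm x < r then - C else \<epsilon> / 2 * W x - (K + 1) * D)" for x
  show ?thesis
  proof (intro exI conjI allI)
    show "0 \<le> \<V> x i" for x i
      by (simp add: \<V>_def U \<beta> \<phi>(2))
    show "C2 (\<lambda>x. \<V> x i)" for i
      unfolding \<V>_def by (rule C2_add_scaled[OF U(1) C2\<phi>])
    show "locally_bounded g"
      unfolding locally_bounded_def
    proof
      fix x
      let ?h = "\<lambda>x. \<epsilon> / 2 * W x - (K + 1) * D"
      have "bounded (?h ` ball x 1)"
        by (intro bounded_continuous_image_ball continuous_intros C2D(3) W(1))
      then have "bounded (insert (- C) (?h ` ball x 1))" by simp
      then have "bounded (g ` ball x 1)"
        by (rule bounded_subset) (auto simp: g_def)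
      then show "\<exists>r>0. bounded (g ` ball x r)"
        using zero_less_one by blast
    qed
    have "filterlim (\<lambda>x. - ((K + 1) * D) + \<epsilon> / 2 * W x) at_top at_infinity"
      using \<epsilon> by (intro filterlim_tendsto_add_at_top[OF tendsto_const]
          filterlim_tendsto_pos_mult_at_top[OF tendsto_const _ W(3)]) auto
    then show "filterlim g at_top at_infinity"
      by (rule filterlim_mono_eventually[OF _ order_refl order_refl])
         (auto simp: g_def eventually_at_infinity intro!: exI[of _ r])
    show "switching_op b \<sigma> q \<V> x i \<le> - g x" for x i
      using C[of x i] r[of x i] by (simp add: g_def)
  qed
qed

section \<open>Multiplicative corrections: the M-matrix case and powers of \<open>V\<close>\<close>

lemma eventually_less_mult_of_Limsup:
  fixes f h :: "'a \<Rightarrow> real"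
  assumes "Limsup F (\<lambda>x. ereal (f x / h x)) < ereal c" and "\<And>x. 0 < h x"
  shows "\<forall>\<^sub>F x in F. f x \<le> c * h x"
  using Limsup_lessD[OF assms(1)] by eventually_elim (use assms(2) in \<open>simp add: field_simps\<close>)

text \<open>A positive multiple of \<open>\<xi>\<close> is at least 1, so it can be written as
  \<open>1 + \<beta>\<close> with \<open>\<beta>\<close> nonnegative; the vector 1 is in the kernel
  of \<open>Q\<close>. With \<open>U = W = V\<close> the drift at infinity is that of
  \<open>V\<close> weighted by this multiple of \<open>\<xi>\<close>.\<close>

lemma lyapunov_function_of_positive_vector:
  fixes b :: "real^'d::finite \<Rightarrow> 's::finite \<Rightarrow> real^'d" and \<sigma> :: "real^'d \<Rightarrow> 's \<Rightarrow> real^'n::finite^'d"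
    and q :: "real^'d \<Rightarrow> real^'s^'s" and \<xi> c :: "real^'s"
  assumes coeff: "coefficients_locally_bounded b \<sigma>"
    and rows: "\<And>x i. (\<Sum>j\<in>UNIV. q x $ i $ j) = 0"
    and Q_limit: "((\<lambda>x. q x - Q) \<longlongrightarrow> 0) at_infinity"
    and Q_rows: "\<And>i. (\<Sum>j\<in>UNIV. Q $ i $ j) = 0"
    and V: "C2 V" "\<And>x. 0 < V x" "filterlim V at_top at_infinity"
    and drift: "\<And>i. \<forall>\<^sub>F x in at_infinity. diffusion_op b \<sigma> i V x \<le> c $ i * V x"
    and \<xi>: "\<And>i. 0 < \<xi> $ i" "\<And>i. (Q *v \<xi>) $ i + c $ i * \<xi> $ i < 0"
  shows "\<exists>(\<V> :: real^'d \<Rightarrow> 's \<Rightarrow> real) (g :: real^'d \<Rightarrow> real).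
      (\<forall>x i. \<V> x i \<ge> 0) \<and> (\<forall>i. C2 (\<lambda>x. \<V> x i)) \<and> locally_bounded g
      \<and> filterlim g at_top at_infinity
      \<and> (\<forall>x i. switching_op b \<sigma> q \<V> x i \<le> - g x)"
proof -
  \<comment> \<open>The sum dominates each reciprocal, which is what makes every component of
    \<open>a *\<^sub>R \<xi>\<close> at least 1.\<close>
  define a where "a = (\<Sum>i\<in>UNIV. 1 / \<xi> $ i)"
  have a: "1 / \<xi> $ i \<le> a" for i
    unfolding a_def by (rule member_le_sum) (auto intro: less_imp_le \<xi>)
  have "0 < 1 / \<xi> $ undefined" using \<xi>(1) by simp
  then have a0: "0 < a" using a order_less_le_trans by blast
  have a\<xi>: "1 \<le> a * \<xi> $ i" for i
    using a[of i] \<xi>(1)[of i] by (simp add: divide_le_eq)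
  \<comment> \<open>The index with the weakest negative drift; it determines a rate
    \<open>\<epsilon>\<close> valid for all regimes.\<close>
  obtain m where m: "\<And>i. (Q *v \<xi>) $ i + c $ i * \<xi> $ i \<le> (Q *v \<xi>) $ m + c $ m * \<xi> $ m"
    using finite_range_attains_max[of "\<lambda>i. (Q *v \<xi>) $ i + c $ i * \<xi> $ i"] by blast
  define \<epsilon> where "\<epsilon> = - a * ((Q *v \<xi>) $ m + c $ m * \<xi> $ m)"
  define \<beta> where "\<beta> = a *\<^sub>R \<xi> - 1"
  have Q\<beta>: "(Q *v \<beta>) $ i = a * (Q *v \<xi>) $ i" for i
    using Q_rows[of i]
    by (simp add: \<beta>_def matrix_vector_mult_def right_diff_distrib sum_subtractf sum_distrib_left ac_simps)
  show ?thesis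
  proof (rule lyapunov_function_of_drift[OF coeff rows Q_limit V(1) less_imp_le[OF V(2)] V])
    show "0 \<le> \<beta> $ i" for i using a\<xi>[of i] by (simp add: \<beta>_def)
    show "0 < \<epsilon>" using a0 \<xi>(2)[of m] by (simp add: \<epsilon>_def mult_less_0_iff)
    have "\<forall>\<^sub>F x in at_infinity. \<forall>i. diffusion_op b \<sigma> i V x \<le> c $ i * V x"
      using drift by (rule eventually_all_finite)
    then show "\<forall>\<^sub>F x in at_infinity. \<forall>i. diffusion_op b \<sigma> i V x + \<beta> $ i * diffusion_op b \<sigma> i V x
      + V x * (Q *v \<beta>) $ i \<le> - \<epsilon> * V x"
    proof eventually_elim
      case (elim x)
      show ?case
      proof
        fix i
        have "diffusion_op b \<sigma> i V x + \<beta> $ i * diffusion_op b \<sigma> i V x + V x * (Q *v \<beta>) $ i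
            = a * (\<xi> $ i * diffusion_op b \<sigma> i V x + V x * (Q *v \<xi>) $ i)"
          by (simp add: Q\<beta>) (simp add: \<beta>_def algebra_simps)
        also have "\<dots> \<le> a * (\<xi> $ i * (c $ i * V x) + V x * (Q *v \<xi>) $ i)"
          using elim[rule_format, of i] a0 \<xi>(1)[of i]
          by (intro mult_left_mono add_right_mono) (auto intro: less_imp_le)
        also have "\<dots> = a * V x * ((Q *v \<xi>) $ i + c $ i * \<xi> $ i)"
          by (simp add: algebra_simps)
        also have "\<dots> \<le> a * V x * ((Q *v \<xi>) $ m + c $ m * \<xi> $ m)"
          using a0 V(2)[of x] by (intro mult_left_mono m) simp
        also have "\<dots> = - \<epsilon> * V x" by (simp add: \<epsilon>_def)
        finally show "diffusion_op b \<sigma> i V x + \<beta> $ i * diffusion_op b \<sigma> i V x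
          + V x * (Q *v \<beta>) $ i \<le> - \<epsilon> * V x" .
      qed
    qed
  qed
qed

lemma C2_halfline_powr:
  "C2_halfline (\<lambda>u. u powr p)"
  "u > 0 \<Longrightarrow> deriv (\<lambda>u. u powr p) u = p * u powr (p - 1)"
  "u > 0 \<Longrightarrow> deriv (deriv (\<lambda>u. u powr p)) u = p * (p - 1) * u powr (p - 2)"
proof -
  have 1: "((\<lambda>u. u powr p) has_real_derivative p * u powr (p - 1)) (at u)" if "u > 0" for u
    using has_real_derivative_powr[OF that] .
  have 2: "((\<lambda>u. p * u powr (p - 1)) has_real_derivative p * (p - 1) * u powr (p - 2)) (at u)"
    if "u > 0" for u
    using DERIV_cmult[OF has_real_derivative_powr[OF that, of "p - 1"], of p]
    by (simp add: algebra_simps)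
  have 3: "continuous_on {0<..} (\<lambda>u. p * (p - 1) * u powr (p - 2))"
    by (intro continuous_intros) auto
  note C = C2_halflineI[of "\<lambda>u. u powr p" "\<lambda>u. p * u powr (p - 1)"
      "\<lambda>u. p * (p - 1) * u powr (p - 2)", OF 1 2 3]
  show "C2_halfline (\<lambda>u. u powr p)"
    "u > 0 \<Longrightarrow> deriv (\<lambda>u. u powr p) u = p * u powr (p - 1)"
    "u > 0 \<Longrightarrow> deriv (deriv (\<lambda>u. u powr p)) u = p * (p - 1) * u powr (p - 2)"
    using C by auto
qed

text \<open>Replacing \<open>V\<close> by \<open>V powr p\<close> for small \<open>p > 0\<close> replaces \<open>c\<close> by \<open>p c\<close>, and
  \<open>(Q + p diag c) (1 + p \<eta>) = - p \<kappa> + p\<^sup>2 c \<eta>\<close> is negative.\<close>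

lemma lyapunov_function_of_subharmonic:
  fixes b :: "real^'d::finite \<Rightarrow> 's::finite \<Rightarrow> real^'d" and \<sigma> :: "real^'d \<Rightarrow> 's \<Rightarrow> real^'n::finite^'d"
    and q :: "real^'d \<Rightarrow> real^'s^'s" and \<eta> c :: "real^'s"
  assumes coeff: "coefficients_locally_bounded b \<sigma>"
    and rows: "\<And>x i. (\<Sum>j\<in>UNIV. q x $ i $ j) = 0"
    and Q_limit: "((\<lambda>x. q x - Q) \<longlongrightarrow> 0) at_infinity"
    and Q_rows: "\<And>i. (\<Sum>j\<in>UNIV. Q $ i $ j) = 0"
    and V: "C2 V" "\<And>x. 0 < V x" "filterlim V at_top at_infinity"
    and drift: "\<And>i. \<forall>\<^sub>F x in at_infinity. diffusion_op b \<sigma> i V x \<le> c $ i * V x"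
    and \<eta>: "\<And>i. 0 \<le> \<eta> $ i" "\<And>i. (Q *v \<eta>) $ i + c $ i = - \<kappa>" and \<kappa>: "0 < \<kappa>"
  shows "\<exists>(\<V> :: real^'d \<Rightarrow> 's \<Rightarrow> real) (g :: real^'d \<Rightarrow> real).
      (\<forall>x i. \<V> x i \<ge> 0) \<and> (\<forall>i. C2 (\<lambda>x. \<V> x i)) \<and> locally_bounded g
      \<and> filterlim g at_top at_infinity
      \<and> (\<forall>x i. switching_op b \<sigma> q \<V> x i \<le> - g x)"
proof -
  define S where "S = (\<Sum>i\<in>UNIV. \<bar>c $ i * \<eta> $ i\<bar>)"
  have S: "c $ i * \<eta> $ i \<le> S" for i
  proof -
    have "\<bar>c $ i * \<eta> $ i\<bar> \<le> S" unfolding S_def by (rule member_le_sum) auto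
    then show ?thesis by linarith
  qed
  have S0: "0 \<le> S" unfolding S_def by (intro sum_nonneg) simp
  \<comment> \<open>\<open>p \<le> 1\<close> makes the power concave. The other bound gives
    \<open>p * S < \<kappa>\<close>, so the term quadratic in \<open>p\<close> cannot outweigh
    \<open>- p * \<kappa>\<close>.\<close>
  define p where "p = min 1 (\<kappa> / (S + 1))"
  have p: "0 < p" "p \<le> 1" using \<kappa> S0 by (auto simp: p_def)
  have "p * S < p * (S + 1)" using p by simp
  also have "\<dots> \<le> \<kappa> / (S + 1) * (S + 1)"
    using S0 by (intro mult_right_mono) (auto simp: p_def)
  finally have pS: "p * S < \<kappa>" using S0 by simp
  show ?thesis
  proof (rule lyapunov_function_of_positive_vector[where \<xi> = "1 + p *\<^sub>R \<eta>" and c = "p *\<^sub>R c"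
        and V = "\<lambda>x. V x powr p", OF coeff rows Q_limit Q_rows])
    show "C2 (\<lambda>x. V x powr p)"
      by (rule C2_compose[OF C2_halfline_powr(1) V(1,2)])
    show "0 < V x powr p" for x using V(2)[of x] by simp
    have "filterlim (\<lambda>u. exp (p * ln u)) at_top (at_top :: real filter)"
      by (intro filterlim_compose[OF exp_at_top] filterlim_tendsto_pos_mult_at_top[OF tendsto_const]
          ln_at_top p)
    then have "filterlim (\<lambda>u. u powr p) at_top (at_top :: real filter)"
      by (rule filterlim_mono_eventually[OF _ order_refl order_refl])
         (use eventually_gt_at_top[of 0] in \<open>eventually_elim, simp add: powr_def\<close>)
    then show "filterlim (\<lambda>x. V x powr p) at_top at_infinity"
      using V(3) by (rule filterlim_compose)
    show "\<forall>\<^sub>F x in at_infinity. diffusion_op b \<sigma> i (\<lambda>x. V x powr p) x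
        \<le> (p *\<^sub>R c) $ i * V x powr p" for i
      using drift[of i]
    proof eventually_elim
      case (elim x)
      \<comment> \<open>By concavity the squared-gradient term of the chain rule is nonpositive and
        can be discarded.\<close>
      have "deriv (deriv (\<lambda>u. u powr p)) (V x) \<le> 0"
        using p by (simp add: C2_halfline_powr(3)[OF V(2)] mult_nonneg_nonpos mult_nonpos_nonneg)
      then have "diffusion_op b \<sigma> i (\<lambda>x. V x powr p) x
          \<le> deriv (\<lambda>u. u powr p) (V x) * diffusion_op b \<sigma> i V x"
        unfolding diffusion_op_compose[OF C2_halfline_powr(1) V(1,2)]
        by (simp add: mult_nonpos_nonneg)
      also have "\<dots> = p * V x powr (p - 1) * diffusion_op b \<sigma> i V x"
        by (simp add: C2_halfline_powr(2)[OF V(2)])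
      also have "\<dots> \<le> p * V x powr (p - 1) * (c $ i * V x)"
        using p elim by (intro mult_left_mono) auto
      also have "\<dots> = p * c $ i * V x powr p"
        using V(2)[of x] by (simp add: powr_diff)
      finally show ?case by simp
    qed
    show "0 < (1 + p *\<^sub>R \<eta>) $ i" for i
      using p \<eta>(1)[of i] by (simp add: add_pos_nonneg)
    show "(Q *v (1 + p *\<^sub>R \<eta>)) $ i + (p *\<^sub>R c) $ i * (1 + p *\<^sub>R \<eta>) $ i < 0" for i
    proof -
      have "(Q *v (1 + p *\<^sub>R \<eta>)) $ i = p * (Q *v \<eta>) $ i"
        using Q_rows[of i]
        by (simp add: matrix_vector_mult_def distrib_left sum.distrib sum_distrib_left ac_simps)
      then have "(Q *v (1 + p *\<^sub>R \<eta>)) $ i + (p *\<^sub>R c) $ i * (1 + p *\<^sub>R \<eta>) $ i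
          = p * ((Q *v \<eta>) $ i + c $ i) + p * (p * (c $ i * \<eta> $ i))"
        by (simp add: algebra_simps)
      also have "\<dots> \<le> p * (- \<kappa>) + p * (p * S)"
        using p S[of i] by (intro add_mono mult_left_mono) (auto simp: \<eta>(2))
      also have "\<dots> = p * (p * S - \<kappa>)" by (simp add: algebra_simps)
      also have "\<dots> < 0" using p pS by (simp add: mult_less_0_iff)
      finally show ?thesis .
    qed
  qed
qed

section \<open>Additive corrections: the case with a concave function\<close>

text \<open>With \<open>V\<close> as the regime-independent part and \<open>\<eta>\<close> as
  weights of \<open>W\<close>, the drift is at most \<open>- \<kappa> * W\<close> plus
  \<open>\<eta>\<close> times the diffusion operator on \<open>W\<close>. The latter is small
  relative to \<open>W\<close> and uses up at most half of \<open>\<kappa>\<close>.\<close>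

lemma lyapunov_function_of_additive_correction:
  fixes b :: "real^'d::finite \<Rightarrow> 's::finite \<Rightarrow> real^'d" and \<sigma> :: "real^'d \<Rightarrow> 's \<Rightarrow> real^'n::finite^'d"
    and q :: "real^'d \<Rightarrow> real^'s^'s" and \<eta> c :: "real^'s"
  assumes coeff: "coefficients_locally_bounded b \<sigma>"
    and rows: "\<And>x i. (\<Sum>j\<in>UNIV. q x $ i $ j) = 0"
    and Q_limit: "((\<lambda>x. q x - Q) \<longlongrightarrow> 0) at_infinity"
    and V: "C2 V" "\<And>x. 0 < V x"
    and W: "C2 W" "\<And>x. 0 < W x" "filterlim W at_top at_infinity"
    and drift: "\<And>i. \<forall>\<^sub>F x in at_infinity. diffusion_op b \<sigma> i V x \<le> c $ i * W x"
    and small: "((\<lambda>x. SUP i. diffusion_op b \<sigma> i W x / W x) \<longlongrightarrow> 0) at_infinity"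
    and \<eta>: "\<And>i. 0 \<le> \<eta> $ i" "\<And>i. (Q *v \<eta>) $ i + c $ i = - \<kappa>" and \<kappa>: "0 < \<kappa>"
  shows "\<exists>(\<V> :: real^'d \<Rightarrow> 's \<Rightarrow> real) (g :: real^'d \<Rightarrow> real).
      (\<forall>x i. \<V> x i \<ge> 0) \<and> (\<forall>i. C2 (\<lambda>x. \<V> x i)) \<and> locally_bounded g
      \<and> filterlim g at_top at_infinity
      \<and> (\<forall>x i. switching_op b \<sigma> q \<V> x i \<le> - g x)"
proof (rule lyapunov_function_of_drift[OF coeff rows Q_limit V(1) less_imp_le[OF V(2)] W \<eta>(1)])
  show "0 < \<kappa> / 2" using \<kappa> by simp
  \<comment> \<open>A bound for \<open>\<eta>\<close> that stays positive when \<open>\<eta>\<close>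
    is 0, so that \<open>\<delta>\<close> below is well defined and positive.\<close>
  define a where "a = norm \<eta> + 1"
  have a: "0 < a" "\<eta> $ i \<le> a" for i
    using component_le_norm_cart[of \<eta> i] norm_ge_zero[of \<eta>] unfolding a_def by linarith+
  define \<delta> where "\<delta> = \<kappa> / 2 / a"
  have \<delta>: "0 < \<delta>" using \<kappa> a by (simp add: \<delta>_def)
  have \<eta>\<delta>: "\<eta> $ i * \<delta> \<le> \<kappa> / 2" for i
    using mult_right_mono[OF a(2)[of i], of \<delta>] \<delta> a(1) by (simp add: \<delta>_def)
  have "\<forall>\<^sub>F x in at_infinity. \<forall>i. diffusion_op b \<sigma> i V x \<le> c $ i * W x"
    using drift by (rule eventually_all_finite)
  moreover have "\<forall>\<^sub>F x in at_infinity. (SUP i. diffusion_op b \<sigma> i W x / W x) < \<delta>"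
    using order_tendstoD(2)[OF small \<delta>] .
  ultimately show "\<forall>\<^sub>F x in at_infinity. \<forall>i. diffusion_op b \<sigma> i V x + \<eta> $ i * diffusion_op b \<sigma> i W x
      + W x * (Q *v \<eta>) $ i \<le> - (\<kappa> / 2) * W x"
  proof eventually_elim
    case (elim x)
    show ?case
    proof
      fix i
      have "diffusion_op b \<sigma> i W x / W x \<le> (SUP i. diffusion_op b \<sigma> i W x / W x)"
        by (rule cSUP_upper) auto
      then have "diffusion_op b \<sigma> i W x \<le> \<delta> * W x"
        using elim(2) W(2)[of x] by (simp add: pos_divide_le_eq[symmetric])
      then have "\<eta> $ i * diffusion_op b \<sigma> i W x \<le> \<eta> $ i * (\<delta> * W x)"
        using \<eta>(1) by (rule mult_left_mono)
      also have "\<dots> \<le> \<kappa> / 2 * W x"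
        using mult_right_mono[OF \<eta>\<delta>[of i], of "W x"] W(2)[of x] by (simp add: mult.assoc)
      finally have "diffusion_op b \<sigma> i V x + \<eta> $ i * diffusion_op b \<sigma> i W x + W x * (Q *v \<eta>) $ i
          \<le> W x * ((Q *v \<eta>) $ i + c $ i) + \<kappa> / 2 * W x"
        using elim(1)[rule_format, of i] by (simp add: algebra_simps)
      then show "diffusion_op b \<sigma> i V x + \<eta> $ i * diffusion_op b \<sigma> i W x
          + W x * (Q *v \<eta>) $ i \<le> - (\<kappa> / 2) * W x"
        unfolding \<eta>(2) by simp
    qed
  qed
qed

text \<open>Row sums pass to the limit entrywise. Under the M-matrix condition \<open>Q\<close> is
  not assumed to be a generator, so this is how it inherits zero row sums from
  \<open>q\<close>.\<close>

lemma row_sum_zero_of_limit: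
  fixes q :: "'a \<Rightarrow> real^'s^'s"
  assumes "((\<lambda>x. q x - Q) \<longlongrightarrow> 0) F" "F \<noteq> bot" "\<And>x i. (\<Sum>j\<in>UNIV. q x $ i $ j) = 0"
  shows "(\<Sum>j\<in>UNIV. Q $ i $ j) = 0"
proof -
  have "((\<lambda>x. (q x - Q) $ i $ j) \<longlongrightarrow> 0 $ i $ j) F" for j
    by (intro tendsto_vec_nth assms(1))
  from tendsto_sum[where I = UNIV and f = "\<lambda>j x. (q x - Q) $ i $ j", OF this] show ?thesis
    using assms(2,3) by (simp add: sum_subtractf tendsto_const_iff)
qed

theorem theorem1p5:
  fixes M :: "'w measure" and F :: "real \<Rightarrow> 'w measure"
    and B :: "real \<Rightarrow> 'w \<Rightarrow> real^'n::finite"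
    and b :: "real^'d::finite \<Rightarrow> 's::finite \<Rightarrow> real^'d"
    and \<sigma> :: "real^'d \<Rightarrow> 's \<Rightarrow> real^'n^'d"
    and X :: "real^'d \<Rightarrow> 's \<Rightarrow> real \<Rightarrow> 'w \<Rightarrow> real^'d"
    and \<Lambda> :: "real^'d \<Rightarrow> 's \<Rightarrow> real \<Rightarrow> 'w \<Rightarrow> 's"
    and q :: "real^'d \<Rightarrow> real^'s^'s" and Q :: "real^'s^'s"
    and c :: "real^'s"
    and N :: "'v measure" and Y :: "'s \<Rightarrow> real \<Rightarrow> 'v \<Rightarrow> 's"
  assumes basis: "stochastic_basis M F"
    and brownian: "brownian_motion M F B"
    and switching: "switching_chain M F X \<Lambda>"
    and generator: "\<And>x. infinitesimal_generator M (\<Lambda> x) (q x)"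
    and A1: "coefficients_locally_bounded b \<sigma>"
    and A2: "\<And>x i. unique_strong_solution M F B b \<sigma> (\<Lambda> x i) x (X x i)"
    and A3: "strong_markov M F X \<Lambda>"
    and A4: "Cb_Feller M X \<Lambda>"
    and A5: "martingale_problem M F b \<sigma> q X \<Lambda>"
    and Q_limit: "((\<lambda>x. q x - Q) \<longlongrightarrow> 0) at_infinity"
    and cases:
      "(markov_chain N Y \<and> infinitesimal_generator N Y Q \<and> irreducible_generator Q
        \<and> (\<exists>\<mu>. invariant_measure N Y \<mu> \<and> (\<Sum>i\<in>UNIV. c $ i * pmf \<mu> i) < 0)
        \<and> (\<exists>V \<theta>. C2 V \<and> (\<forall>x. V x > 0)
             \<and> C2_halfline \<theta> \<and> concave_on {0<..} \<theta> \<and> (\<forall>u>0. \<theta> u > 0)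
             \<and> filterlim (\<lambda>x. \<theta> (V x)) at_top at_infinity
             \<and> (\<forall>i. Limsup at_infinity (\<lambda>x. ereal (diffusion_op b \<sigma> i V x / \<theta> (V x))) < ereal (c $ i))
             \<and> ((\<lambda>x. \<theta> (V x) / V x) \<longlongrightarrow> 0) at_infinity
             \<and> ((\<lambda>x. SUP i. diffusion_op b \<sigma> i (\<lambda>y. \<theta> (V y)) x / \<theta> (V x)) \<longlongrightarrow> 0) at_infinity))
       \<or>
       (markov_chain N Y \<and> infinitesimal_generator N Y Q \<and> irreducible_generator Q
        \<and> (\<exists>\<mu>. invariant_measure N Y \<mu> \<and> (\<Sum>i\<in>UNIV. c $ i * pmf \<mu> i) < 0)
        \<and> (\<exists>V. C2 V \<and> (\<forall>x. V x > 0) \<and> filterlim V at_top at_infinity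
             \<and> (\<forall>i. Limsup at_infinity (\<lambda>x. ereal (diffusion_op b \<sigma> i V x / V x)) < ereal (c $ i))))
       \<or>
       (M_matrix (- (Q + diag c)) \<and> invertible (- (Q + diag c))
        \<and> (\<exists>V. C2 V \<and> (\<forall>x. V x > 0) \<and> filterlim V at_top at_infinity
             \<and> (\<forall>i. Limsup at_infinity (\<lambda>x. ereal (diffusion_op b \<sigma> i V x / V x)) < ereal (c $ i))))"
  shows "\<exists>(\<V> :: real^'d \<Rightarrow> 's \<Rightarrow> real) (g :: real^'d \<Rightarrow> real).
      (\<forall>x i. \<V> x i \<ge> 0) \<and> (\<forall>i. C2 (\<lambda>x. \<V> x i)) \<and> locally_bounded g
      \<and> filterlim g at_top at_infinity
      \<and> (\<forall>x i. switching_op b \<sigma> q \<V> x i \<le> - g x)"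
proof -
  have rows: "(\<Sum>j\<in>UNIV. q x $ i $ j) = 0" for x i
    by (rule infinitesimal_generator_row_sum[OF generator])
  have Q_rows: "(\<Sum>j\<in>UNIV. Q $ i $ j) = 0" for i
    by (rule row_sum_zero_of_limit[OF Q_limit trivial_limit_at_infinity rows])
  note lyapunov = A1 rows Q_limit
  from cases show ?thesis
  proof (elim disjE conjE exE)
    fix \<mu> V \<theta>
    assume chain: "markov_chain N Y" "infinitesimal_generator N Y Q" "irreducible_generator Q"
        "invariant_measure N Y \<mu>" "(\<Sum>i\<in>UNIV. c $ i * pmf \<mu> i) < 0"
      and V: "C2 V" "\<forall>x. V x > 0" and \<theta>: "C2_halfline \<theta>" "\<forall>u>0. \<theta> u > 0"
      and lim: "filterlim (\<lambda>x. \<theta> (V x)) at_top at_infinity"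
      and drift: "\<forall>i. Limsup at_infinity (\<lambda>x. ereal (diffusion_op b \<sigma> i V x / \<theta> (V x))) < ereal (c $ i)"
      and small: "((\<lambda>x. SUP i. diffusion_op b \<sigma> i (\<lambda>y. \<theta> (V y)) x / \<theta> (V x)) \<longlongrightarrow> 0) at_infinity"
    obtain \<eta> \<kappa> where "0 < \<kappa>" and \<eta>: "\<And>i. 0 \<le> \<eta> $ i" "\<And>i. (Q *v \<eta>) $ i + c $ i = - \<kappa>"
      using invariant_measure_subharmonic[OF chain] by blast
    have pos: "0 < V x" "0 < \<theta> (V x)" for x using V(2) \<theta>(2) by auto
    show ?thesis
      by (rule lyapunov_function_of_additive_correction[OF lyapunov V(1) pos(1) C2_compose(1)[OF \<theta>(1) V(1) pos(1)]
            pos(2) lim eventually_less_mult_of_Limsup[OF drift[rule_format] pos(2)] small \<eta> \<open>0 < \<kappa>\<close>])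
  next
    fix \<mu> V
    assume chain: "markov_chain N Y" "infinitesimal_generator N Y Q" "irreducible_generator Q"
        "invariant_measure N Y \<mu>" "(\<Sum>i\<in>UNIV. c $ i * pmf \<mu> i) < 0"
      and V: "C2 V" "\<forall>x. V x > 0" "filterlim V at_top at_infinity"
      and drift: "\<forall>i. Limsup at_infinity (\<lambda>x. ereal (diffusion_op b \<sigma> i V x / V x)) < ereal (c $ i)"
    obtain \<eta> \<kappa> where "0 < \<kappa>" and \<eta>: "\<And>i. 0 \<le> \<eta> $ i" "\<And>i. (Q *v \<eta>) $ i + c $ i = - \<kappa>"
      using invariant_measure_subharmonic[OF chain] by blast
    have pos: "0 < V x" for x using V(2) by auto
    show ?thesis
      by (rule lyapunov_function_of_subharmonic[OF lyapunov Q_rows V(1) pos V(3)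
            eventually_less_mult_of_Limsup[OF drift[rule_format] pos] \<eta> \<open>0 < \<kappa>\<close>])
  next
    fix V
    assume M: "M_matrix (- (Q + diag c))" "invertible (- (Q + diag c))"
      and V: "C2 V" "\<forall>x. V x > 0" "filterlim V at_top at_infinity"
      and drift: "\<forall>i. Limsup at_infinity (\<lambda>x. ereal (diffusion_op b \<sigma> i V x / V x)) < ereal (c $ i)"
    obtain \<xi> where \<xi>: "\<And>i. 0 < \<xi> $ i" "\<And>i. 0 < (- (Q + diag c) *v \<xi>) $ i"
      using M_matrix_positive_vector[OF M] by blast
    have "(Q *v \<xi>) $ i + c $ i * \<xi> $ i < 0" for i
    proof -
      have "(diag c *v \<xi>) $ i = c $ i * \<xi> $ i"
        by (simp add: diag_def matrix_vector_mult_def if_distrib[of "\<lambda>a. a * _"] cong: if_cong)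
      moreover have "(- (Q + diag c) *v \<xi>) $ i = - ((Q *v \<xi>) $ i + (diag c *v \<xi>) $ i)"
        by (simp add: matrix_vector_mult_def sum.distrib sum_negf distrib_right
            left_diff_distrib sum_subtractf)
      ultimately show ?thesis using \<xi>(2)[of i] by simp
    qed
    moreover have pos: "0 < V x" for x using V(2) by auto
    ultimately show ?thesis
      using lyapunov_function_of_positive_vector[OF lyapunov Q_rows V(1) pos V(3)
            eventually_less_mult_of_Limsup[OF drift[rule_format] pos] \<xi>(1)] by blast
  qed
qed

end
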